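(* Let $\tfrac12<p=1-q<1$ and $c\in\mathbb R$, and let $\underline\pi^c$ be the product blocking measure of the asymmetric simple exclusion process on $\mathbb Z$, i.e. the product over $i\in\mathbb Z$ of Bernoulli distributions on $\{0,1\}$ with parameters $\varrho_i=\frac{e^c(p/q)^i}{1+e^c(p/q)^i}$. Put $$K^c=\sum_{j=-\infty}^\infty\Bigl(\frac qp\Bigr)^{\frac{j^2+j}2}e^{-cj}.$$ Then for every $n\in\mathbb Z$ $$\underline\pi^c\{N(\underline\eta)=n\}=\frac1{K^c}\Bigl(\frac qp\Bigr)^{\frac{n^2+n}2}e^{-cn},$$ and $\underline\pi^c$ has the ergodic decomposition $$\underline\pi^c=\sum_{n=-\infty}^\infty\underline\nu^n\cdot\frac1{K^c}\Bigl(\frac qp\Bigr)^{\frac{n^2+n}2}e^{-cn}.$$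
   Context: For $\underline a\in\{0,1\}^{\mathbb Z}$ let $N_{\mathrm p}(\underline a)=\sum_{i\le0}a_i$ and $N_{\mathrm h}(\underline a)=\sum_{i\ge1}(1-a_i)$. Let $H=\{\underline a\in\{0,1\}^{\mathbb Z}:N_{\mathrm p}(\underline a)<\infty,\ N_{\mathrm h}(\underline a)<\infty\}$, on which $\underline\pi^c$ is concentrated, and for $\underline a\in H$ let $N(\underline a)=N_{\mathrm h}(\underline a)-N_{\mathrm p}(\underline a)\in\mathbb Z$. Let $H^n=\{\underline a\in H:N(\underline a)=n\}$. The asymmetric simple exclusion process (ASEP) is the Markov chain on $H$ in which each particle (site with value $1$) jumps at rate $p$ one step to the right and at rate $q$ one step to the left, jumps to occupied sites being suppressed; the sets $H^n$ are its closed irreducible components. $\underline\nu^n=\underline\pi^c(\,\cdot\mid N(\underline\eta)=n)$ is the conditional distribution on $H^n$; it does not depend on $c$ and is the unique stationary distribution of ASEP on $H^n$. In the claim $\underline\eta$ denotes a random configuration with distribution $\underline\pi^c$. *)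

theory Defs
  imports "HOL-Probability.Probability"
begin

definition exit_rate :: "'s set \<Rightarrow> ('s \<Rightarrow> 's \<Rightarrow> real) \<Rightarrow> 's \<Rightarrow> real" where
  "exit_rate S r x = (\<Sum>\<^sub>\<infinity>y\<in>S. r x y)"

text \<open>
  Feller's construction of the Markov chain on the countable set \<open>S\<close> with jump rates \<open>r\<close>:
  \<open>jump_transition S r m t x y\<close> is the probability that the chain started from \<open>x\<close> makes
  exactly \<open>m\<close> jumps during \<open>[0,t]\<close> and is in \<open>y\<close> at time \<open>t\<close>. The recursion conditions on the
  time \<open>s\<close> and the target \<open>z\<close> of the first jump. Summing over \<open>m\<close> gives the transition
  probabilities. Their total mass is not assumed to be 1, i.e. absence of explosion is not
  built into the definition.
\<close>

fun jump_transition ::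
    "'s set \<Rightarrow> ('s \<Rightarrow> 's \<Rightarrow> real) \<Rightarrow> nat \<Rightarrow> real \<Rightarrow> 's \<Rightarrow> 's \<Rightarrow> ennreal" where
  "jump_transition S r 0 t x y = (if x = y then ennreal (exp (- exit_rate S r x * t)) else 0)"
| "jump_transition S r (Suc m) t x y =
     (\<integral>\<^sup>+ s\<in>{0..t}. ennreal (exp (- exit_rate S r x * s)) *
        (\<integral>\<^sup>+ z. ennreal (r x z) * jump_transition S r m (t - s) z y \<partial>count_space S) \<partial>lborel)"

definition transition :: "'s set \<Rightarrow> ('s \<Rightarrow> 's \<Rightarrow> real) \<Rightarrow> real \<Rightarrow> 's \<Rightarrow> 's \<Rightarrow> ennreal" where
  "transition S r t x y = (\<Sum>m. jump_transition S r m t x y)"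

text \<open>The measure may live on a larger space than \<open>S\<close>; it has to be concentrated on \<open>S\<close>.\<close>

definition stationary_distribution :: "'s set \<Rightarrow> ('s \<Rightarrow> 's \<Rightarrow> real) \<Rightarrow> 's measure \<Rightarrow> bool" where
  "stationary_distribution S r \<mu> \<longleftrightarrow>
     prob_space \<mu> \<and> (AE x in \<mu>. x \<in> S) \<and>
     (\<forall>t\<ge>0. \<forall>y\<in>S.
        (\<integral>\<^sup>+ x. emeasure \<mu> {x} * transition S r t x y \<partial>count_space S) = emeasure \<mu> {y})"

definition invariant_set ::
    "'s set \<Rightarrow> ('s \<Rightarrow> 's \<Rightarrow> real) \<Rightarrow> 's measure \<Rightarrow> 's set \<Rightarrow> bool" where
  "invariant_set S r \<mu> A \<longleftrightarrow>
     A \<subseteq> S \<and> (\<forall>t\<ge>0. AE x in \<mu>. (\<integral>\<^sup>+ y. transition S r t x y \<partial>count_space A) = indicator A x)"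

definition ergodic_distribution :: "'s set \<Rightarrow> ('s \<Rightarrow> 's \<Rightarrow> real) \<Rightarrow> 's measure \<Rightarrow> bool" where
  "ergodic_distribution S r \<mu> \<longleftrightarrow>
     stationary_distribution S r \<mu> \<and>
     (\<forall>A. invariant_set S r \<mu> A \<longrightarrow> emeasure \<mu> A = 0 \<or> emeasure \<mu> A = 1)"

text \<open>\<open>True\<close> stands for 1 (an occupied site), \<open>False\<close> for 0.\<close>

type_synonym config = "int \<Rightarrow> bool"

definition N_p :: "config \<Rightarrow> enat" where
  "N_p a = (\<Sum>\<^sub>\<infinity>i\<in>{..0}. of_bool (a i))"

definition N_h :: "config \<Rightarrow> enat" where
  "N_h a = (\<Sum>\<^sub>\<infinity>i\<in>{1..}. 1 - of_bool (a i))"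

definition H :: "config set" where
  "H = {a. N_p a < \<infinity> \<and> N_h a < \<infinity>}"

text \<open>Only meaningful on \<open>H\<close>.\<close>

definition N :: "config \<Rightarrow> int" where
  "N a = int (the_enat (N_h a)) - int (the_enat (N_p a))"

definition H_level :: "int \<Rightarrow> config set" where
  "H_level n = {a \<in> H. N a = n}"

definition move :: "config \<Rightarrow> int \<Rightarrow> int \<Rightarrow> config" where
  "move a i j = a(i := False, j := True)"

definition asep_rate :: "real \<Rightarrow> real \<Rightarrow> config \<Rightarrow> config \<Rightarrow> real" where
  "asep_rate p q a b =
     (if \<exists>i. a i \<and> \<not> a (i + 1) \<and> b = move a i (i + 1) then p else 0) +
     (if \<exists>i. a i \<and> \<not> a (i - 1) \<and> b = move a i (i - 1) then q else 0)"

definition rho :: "real \<Rightarrow> real \<Rightarrow> real \<Rightarrow> int \<Rightarrow> real" where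
  "rho p q c i = exp c * (p / q) powi i / (1 + exp c * (p / q) powi i)"

definition blocking :: "real \<Rightarrow> real \<Rightarrow> real \<Rightarrow> config measure" where
  "blocking p q c = (\<Pi>\<^sub>M i\<in>UNIV. measure_pmf (bernoulli_pmf (rho p q c i)))"

text \<open>\<open>uniform_measure M A\<close> is the conditional distribution of \<open>M\<close> given \<open>A\<close>.\<close>

definition nu :: "real \<Rightarrow> real \<Rightarrow> real \<Rightarrow> int \<Rightarrow> config measure" where
  "nu p q c n = uniform_measure (blocking p q c) (H_level n)"

definition K :: "real \<Rightarrow> real \<Rightarrow> real \<Rightarrow> real" where
  "K p q c = (\<Sum>\<^sub>\<infinity>j\<in>(UNIV :: int set).
     (q / p) powr ((real_of_int j ^ 2 + real_of_int j) / 2) * exp (- c * real_of_int j))"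

definition weight :: "real \<Rightarrow> real \<Rightarrow> real \<Rightarrow> int \<Rightarrow> real" where
  "weight p q c n =
     1 / K p q c * (q / p) powr ((real_of_int n ^ 2 + real_of_int n) / 2) * exp (- c * real_of_int n)"

end

theory Submission
  imports Defs
begin

text \<open>
  The distribution of \<open>N\<close> comes from comparing each configuration with its translate.
  Adding a particle at site \<open>i\<close> multiplies the blocking measure of a configuration by the odds
  \<open>e\<^sup>c (p/q)\<^sup>i\<close> (lemma \<open>measure_add_particle\<close>). Along the one-site changes that lead from
  the step configuration to any other configuration in \<open>H\<close>, this shows that translating by one
  site multiplies the measure of \<open>a\<close> by \<open>e\<^sup>-\<^sup>c (q/p)\<^bsup>N(a)+1\<^esup>\<close> (\<open>measure_shift\<close>).
  As translation maps level \<open>n\<close> onto level \<open>n + 1\<close>, the mass of each level is the claimed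
  weight times that of level 0. By Borel--Cantelli, \<open>H\<close> has full measure, so these masses
  sum to 1, which identifies the constant as \<open>1 / K\<^sup>c\<close>. The decomposition is then
  countable additivity.

  Stationarity rests on detailed balance (\<open>measure_hop_right\<close>). Comparing the first-jump and the
  last-jump recursion shows that the transition probabilities inherit it
  (\<open>transition_reversible\<close>). What remains is that no mass is lost by explosion. By
  reversibility, the chain started from \<open>x\<close> sits in \<open>y\<close> with probability at most \<open>m y / m x\<close>, so
  the expected number of its jumps up to time \<open>t\<close> is at most \<open>t / m x\<close> times the mean jump rate
  under \<open>m\<close>, hence finite (\<open>overshoot_sum_le\<close>, \<open>transition_sum_eq_1\<close>). The mean jump rate is
  controlled by the expected number of defects, a convergent geometric series.

  For ergodicity, two configurations that differ by a jump lie both inside or both outside an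
  invariant set, and every configuration of level \<open>n\<close> is joined to the step at \<open>n\<close> by jumps to
  the right (\<open>level_connected\<close>).
\<close>

section \<open>Convolution on the half-line\<close>

text \<open>
  Written with convolutions, the recursion for \<open>jump_transition\<close> becomes algebra: exchanging
  integrals turns into associativity and commutativity.
\<close>

definition conv :: "(real \<Rightarrow> ennreal) \<Rightarrow> (real \<Rightarrow> ennreal) \<Rightarrow> real \<Rightarrow> ennreal" where
  "conv f g t = (\<integral>\<^sup>+ s. f s * g (t - s) * indicator {0..t} s \<partial>lborel)"

lemma conv_cong:
  assumes "\<And>s. 0 \<le> s \<Longrightarrow> s \<le> t \<Longrightarrow> f s = f' s" "\<And>s. 0 \<le> s \<Longrightarrow> s \<le> t \<Longrightarrow> g s = g' s"
  shows "conv f g t = conv f' g' t"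
  unfolding conv_def by (intro nn_integral_cong) (auto simp: assms split: split_indicator)

lemma conv_mono:
  assumes "\<And>s. 0 \<le> s \<Longrightarrow> s \<le> t \<Longrightarrow> f s \<le> f' s" "\<And>s. 0 \<le> s \<Longrightarrow> s \<le> t \<Longrightarrow> g s \<le> g' s"
  shows "conv f g t \<le> conv f' g' t"
  unfolding conv_def by (intro nn_integral_mono) (auto intro!: mult_mono assms split: split_indicator)

lemma borel_measurable_conv [measurable]:
  assumes [measurable]: "f \<in> borel_measurable borel" "g \<in> borel_measurable borel"
  shows "conv f g \<in> borel_measurable borel"
proof -
  have "(\<lambda>t. \<integral>\<^sup>+ s. f s * g (t - s) * (if 0 \<le> s \<and> s \<le> t then 1 else 0) \<partial>lborel)
      \<in> borel_measurable borel"
    by measurable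
  also have "(\<lambda>t. \<integral>\<^sup>+ s. f s * g (t - s) * (if 0 \<le> s \<and> s \<le> t then 1 else 0) \<partial>lborel) = conv f g"
    unfolding conv_def by (intro ext nn_integral_cong) (auto split: split_indicator)
  finally show ?thesis .
qed

lemma conv_commute:
  assumes [measurable]: "f \<in> borel_measurable borel" "g \<in> borel_measurable borel"
  shows "conv f g t = conv g f t"
proof -
  have "conv f g t = (\<integral>\<^sup>+ s. f (t + (-1) * s) * g (t - (t + (-1) * s)) * indicator {0..t} (t + (-1) * s) \<partial>lborel)"
    unfolding conv_def by (subst nn_integral_real_affine[where c="-1" and t=t]) auto
  also have "\<dots> = conv g f t"
    unfolding conv_def by (intro nn_integral_cong) (auto split: split_indicator simp: mult.commute)
  finally show ?thesis .
qed

lemma conv_assoc: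
  assumes [measurable]: "f \<in> borel_measurable borel" "g \<in> borel_measurable borel"
    "h \<in> borel_measurable borel"
  shows "conv (conv f g) h t = conv f (conv g h) t"
proof -
  define F where "F u s = f u * g (s - u) * h (t - s) * (if 0 \<le> u \<and> u \<le> s \<and> s \<le> t then 1 else 0)"
    for u s
  have [measurable]: "(\<lambda>(u, s). F u s) \<in> borel_measurable (borel \<Otimes>\<^sub>M borel)"
    unfolding F_def by measurable
  have "conv (conv f g) h t =
      (\<integral>\<^sup>+ s. (\<integral>\<^sup>+ u. f u * g (s - u) * indicator {0..s} u \<partial>lborel) * (h (t - s) * indicator {0..t} s) \<partial>lborel)"
    unfolding conv_def by (intro nn_integral_cong) (simp add: mult.assoc)
  also have "\<dots> = (\<integral>\<^sup>+ s. (\<integral>\<^sup>+ u. f u * g (s - u) * indicator {0..s} u * (h (t - s) * indicator {0..t} s) \<partial>lborel) \<partial>lborel)"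
    by (intro nn_integral_cong nn_integral_multc[symmetric]) auto
  also have "\<dots> = (\<integral>\<^sup>+ s. \<integral>\<^sup>+ u. F u s \<partial>lborel \<partial>lborel)"
    unfolding F_def by (intro nn_integral_cong) (auto split: split_indicator simp: mult_ac)
  also have "\<dots> = (\<integral>\<^sup>+ u. \<integral>\<^sup>+ s. F u s \<partial>lborel \<partial>lborel)"
    by (rule lborel_pair.Fubini') measurable
  also have "\<dots> = (\<integral>\<^sup>+ u. \<integral>\<^sup>+ v. F u (u + 1 * v) \<partial>lborel \<partial>lborel)"
  proof (rule nn_integral_cong)
    fix u
    have [measurable]: "F u \<in> borel_measurable borel"
      unfolding F_def by measurable
    show "(\<integral>\<^sup>+ s. F u s \<partial>lborel) = (\<integral>\<^sup>+ v. F u (u + 1 * v) \<partial>lborel)"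
      by (subst nn_integral_real_affine[where c=1 and t=u]) auto
  qed
  also have "\<dots> = (\<integral>\<^sup>+ u. (\<integral>\<^sup>+ v. f u * indicator {0..t} u * (g v * h (t - u - v) * indicator {0..t-u} v) \<partial>lborel) \<partial>lborel)"
    unfolding F_def
    by (intro nn_integral_cong) (auto split: split_indicator simp: mult_ac diff_diff_eq)
  also have "\<dots> = (\<integral>\<^sup>+ u. f u * indicator {0..t} u * (\<integral>\<^sup>+ v. g v * h (t - u - v) * indicator {0..t-u} v \<partial>lborel) \<partial>lborel)"
    by (intro nn_integral_cong nn_integral_cmult) auto
  also have "\<dots> = conv f (conv g h) t"
    unfolding conv_def by (intro nn_integral_cong) (simp add: mult_ac)
  finally show ?thesis .
qed

lemma conv_cmult_right:
  assumes [measurable]: "f \<in> borel_measurable borel" "g \<in> borel_measurable borel"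
  shows "conv f (\<lambda>s. c * g s) t = c * conv f g t"
proof -
  have "conv f (\<lambda>s. c * g s) t = (\<integral>\<^sup>+ s. c * (f s * g (t - s) * indicator {0..t} s) \<partial>lborel)"
    unfolding conv_def by (intro nn_integral_cong) (simp add: mult_ac)
  then show ?thesis unfolding conv_def by (simp add: nn_integral_cmult)
qed

lemma conv_add_right:
  assumes [measurable]: "f \<in> borel_measurable borel" "g \<in> borel_measurable borel"
    "h \<in> borel_measurable borel"
  shows "conv f (\<lambda>s. g s + h s) t = conv f g t + conv f h t"
  unfolding conv_def by (subst nn_integral_add[symmetric]) (auto simp: distrib_left distrib_right)

lemma borel_measurable_nn_integral_count_space:
  assumes "countable S" and [measurable]: "\<And>z. z \<in> S \<Longrightarrow> g z \<in> borel_measurable M"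
  shows "(\<lambda>t. \<integral>\<^sup>+ z. g z t \<partial>count_space S) \<in> borel_measurable M"
proof cases
  assume "finite S" then show ?thesis by (simp add: nn_integral_count_space_finite)
next
  assume "infinite S"
  note * = bij_betw_from_nat_into[OF assms(1) this]
  have [simp]: "S \<noteq> {}" using \<open>infinite S\<close> by auto
  show ?thesis
    by (simp add: nn_integral_bij_count_space[symmetric, OF *] nn_integral_count_space_nat from_nat_into)
qed

lemma conv_sum_right:
  assumes "countable S" and [measurable]: "f \<in> borel_measurable borel"
    "\<And>z. z \<in> S \<Longrightarrow> g z \<in> borel_measurable borel"
  shows "conv f (\<lambda>s. \<integral>\<^sup>+ z. g z s \<partial>count_space S) t = (\<integral>\<^sup>+ z. conv f (g z) t \<partial>count_space S)"
proof -
  have "conv f (\<lambda>s. \<integral>\<^sup>+ z. g z s \<partial>count_space S) t =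
     (\<integral>\<^sup>+ s. \<integral>\<^sup>+ z. f s * g z (t - s) * indicator {0..t} s \<partial>count_space S \<partial>lborel)"
    unfolding conv_def
    by (intro nn_integral_cong) (simp add: nn_integral_cmult nn_integral_multc)
  also have "\<dots> = (\<integral>\<^sup>+ z. conv f (g z) t \<partial>count_space S)"
    unfolding conv_def by (rule nn_integral_count_space_nn_integral) (auto simp: assms(1))
  finally show ?thesis .
qed

lemma conv_sum_left:
  assumes "countable S" and [measurable]: "f \<in> borel_measurable borel"
    "\<And>z. z \<in> S \<Longrightarrow> g z \<in> borel_measurable borel"
  shows "conv (\<lambda>s. \<integral>\<^sup>+ z. g z s \<partial>count_space S) f t = (\<integral>\<^sup>+ z. conv (g z) f t \<partial>count_space S)"
proof -
  have [measurable]: "(\<lambda>s. \<integral>\<^sup>+ z. g z s \<partial>count_space S) \<in> borel_measurable borel"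
    by (rule borel_measurable_nn_integral_count_space) (auto simp: assms)
  show ?thesis
    by (subst conv_commute) (auto simp: conv_sum_right assms conv_commute[of f] cong: nn_integral_cong_simp)
qed

lemma conv_cmult_left:
  assumes [measurable]: "f \<in> borel_measurable borel" "g \<in> borel_measurable borel"
  shows "conv (\<lambda>s. c * f s) g t = c * conv f g t"
  by (subst conv_commute) (auto simp: conv_cmult_right conv_commute[of g])

lemma nn_integral_count_space_swap:
  fixes f :: "'a \<Rightarrow> 'b \<Rightarrow> ennreal"
  assumes "countable A"
  shows "(\<integral>\<^sup>+ x. \<integral>\<^sup>+ y. f x y \<partial>count_space B \<partial>count_space A) =
    (\<integral>\<^sup>+ y. \<integral>\<^sup>+ x. f x y \<partial>count_space A \<partial>count_space B)"
  by (rule nn_integral_count_space_nn_integral[symmetric]) (auto simp: assms)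

section \<open>Reversible jump chains\<close>

locale jump_chain =
  fixes S :: "'s set" and r :: "'s \<Rightarrow> 's \<Rightarrow> real"
  assumes countable_S: "countable S"
    and rate_nonneg: "r x y \<ge> 0"
    and finite_rates: "x \<in> S \<Longrightarrow> finite {y \<in> S. r x y \<noteq> 0}"
begin

abbreviation R :: "'s \<Rightarrow> 's \<Rightarrow> ennreal" where "R x y \<equiv> ennreal (r x y)"
abbreviation E :: "'s \<Rightarrow> real \<Rightarrow> ennreal" where "E x s \<equiv> ennreal (exp (- exit_rate S r x * s))"
abbreviation J :: "nat \<Rightarrow> 's \<Rightarrow> 's \<Rightarrow> real \<Rightarrow> ennreal" where "J m x y t \<equiv> jump_transition S r m t x y"

lemma exit_rate_nonneg: "exit_rate S r x \<ge> 0"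
  unfolding exit_rate_def by (rule infsum_nonneg) (rule rate_nonneg)

lemma sum_rates:
  assumes "x \<in> S" shows "(\<integral>\<^sup>+ y. R x y \<partial>count_space S) = ennreal (exit_rate S r x)"
proof -
  let ?T = "{y \<in> S. r x y \<noteq> 0}"
  have "(\<integral>\<^sup>+ y. R x y \<partial>count_space S) = (\<Sum>y\<in>?T. R x y)"
    by (rule nn_integral_count_space') (use finite_rates[OF assms] in auto)
  also have "\<dots> = ennreal (\<Sum>y\<in>?T. r x y)"
    by (simp add: rate_nonneg)
  also have "(\<Sum>y\<in>?T. r x y) = (\<Sum>\<^sub>\<infinity>y\<in>?T. r x y)"
    using finite_rates[OF assms] by simp
  also have "\<dots> = exit_rate S r x"
    unfolding exit_rate_def by (rule infsum_cong_neutral) auto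
  finally show ?thesis .
qed

lemma measurable_J [measurable]: "J m x y \<in> borel_measurable borel"
proof (induction m arbitrary: x y)
  case (Suc m)
  have [measurable]: "(\<lambda>s. \<integral>\<^sup>+ z. R x z * J m z y s \<partial>count_space S) \<in> borel_measurable borel"
    by (rule borel_measurable_nn_integral_count_space[OF countable_S])
       (use Suc in measurable)
  have "J (Suc m) x y = conv (E x) (\<lambda>s. \<integral>\<^sup>+ z. R x z * J m z y s \<partial>count_space S)"
    by (rule ext) (simp add: conv_def)
  then show ?case by simp
qed simp

lemma J_first_jump: "J (Suc m) x y t = (\<integral>\<^sup>+ z. R x z * conv (E x) (J m z y) t \<partial>count_space S)"
proof -
  have "J (Suc m) x y t = conv (E x) (\<lambda>s. \<integral>\<^sup>+ z. R x z * J m z y s \<partial>count_space S) t"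
    by (simp add: conv_def)
  also have "\<dots> = (\<integral>\<^sup>+ z. conv (E x) (\<lambda>s. R x z * J m z y s) t \<partial>count_space S)"
    by (rule conv_sum_right) (auto simp: countable_S)
  finally show ?thesis by (simp add: conv_cmult_right)
qed

lemma nn_integral_single:
  assumes "x \<in> S" "\<And>z. z \<in> S \<Longrightarrow> z \<noteq> x \<Longrightarrow> f z = 0"
  shows "(\<integral>\<^sup>+ z. f z \<partial>count_space S) = f x"
  by (subst nn_integral_count_space'[where A="{x}"]) (use assms in auto)

lemma conv_zero [simp]: "conv f (\<lambda>_. 0) t = 0" "conv (\<lambda>_. 0) f t = 0"
  by (auto simp: conv_def)

text \<open>
  Conditioning on the last jump instead of the first one: a path contributes a product of rates
  times an iterated convolution of exponentials, and convolution is associative. Together with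
  the defining recursion this gives the time reversal of paths.
\<close>

lemma J_last_jump:
  assumes "x \<in> S" "y \<in> S"
  shows "J (Suc m) x y t = (\<integral>\<^sup>+ z. R z y * conv (J m x z) (E y) t \<partial>count_space S)"
  using assms(1)
proof (induction m arbitrary: x t)
  case 0
  have "J (Suc 0) x y t = R x y * conv (E x) (E y) t"
    unfolding J_first_jump
    by (subst nn_integral_single[of y]) (auto simp: assms)
  also have "\<dots> = (\<integral>\<^sup>+ z. R z y * conv (J 0 x z) (E y) t \<partial>count_space S)"
    by (subst nn_integral_single[of x]) (auto simp: 0)
  finally show ?case .
next
  case (Suc m)
  have "J (Suc (Suc m)) x y t =
      (\<integral>\<^sup>+ z. R x z * conv (E x) (\<lambda>s. \<integral>\<^sup>+ w. R w y * conv (J m z w) (E y) s \<partial>count_space S) t \<partial>count_space S)"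
    by (subst J_first_jump, intro nn_integral_cong arg_cong2[where f="(*)"] conv_cong refl Suc.IH) auto
  also have "\<dots> = (\<integral>\<^sup>+ z. \<integral>\<^sup>+ w. R x z * (R w y * conv (E x) (conv (J m z w) (E y)) t) \<partial>count_space S \<partial>count_space S)"
    by (simp add: conv_sum_right[OF countable_S] conv_cmult_right nn_integral_cmult)
  also have "\<dots> = (\<integral>\<^sup>+ w. \<integral>\<^sup>+ z. R x z * (R w y * conv (E x) (conv (J m z w) (E y)) t) \<partial>count_space S \<partial>count_space S)"
    by (rule nn_integral_count_space_swap[OF countable_S])
  also have "\<dots> = (\<integral>\<^sup>+ w. R w y * (\<integral>\<^sup>+ z. R x z * conv (conv (E x) (J m z w)) (E y) t \<partial>count_space S) \<partial>count_space S)"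
    by (simp add: conv_assoc mult.left_commute nn_integral_cmult)
  also have "\<dots> = (\<integral>\<^sup>+ w. R w y * conv (\<lambda>s. \<integral>\<^sup>+ z. R x z * conv (E x) (J m z w) s \<partial>count_space S) (E y) t \<partial>count_space S)"
    by (simp add: conv_sum_left[OF countable_S] conv_cmult_left)
  also have "\<dots> = (\<integral>\<^sup>+ w. R w y * conv (J (Suc m) x w) (E y) t \<partial>count_space S)"
    by (simp only: J_first_jump)
  finally show ?case .
qed

lemma J_0_eq: "J 0 x y = (\<lambda>t. if x = y then E x t else 0)"
  by auto

text \<open>
  The probability of more than \<open>m\<close> jumps during \<open>[0,t]\<close>: jump number \<open>m + 1\<close> leaves the state
  \<open>y\<close>, reached after exactly \<open>m\<close> jumps, at rate \<open>exit_rate S r y\<close>, and what happens afterwards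
  is free.
\<close>

definition overshoot :: "nat \<Rightarrow> 's \<Rightarrow> real \<Rightarrow> ennreal" where
  "overshoot m x t = (\<integral>\<^sup>+ y. ennreal (exit_rate S r y) * conv (J m x y) (\<lambda>_. 1) t \<partial>count_space S)"

text \<open>
  A holding time is either longer than \<open>t\<close> or ends at some \<open>s \<le> t\<close>.
\<close>

lemma exp_conv:
  assumes "0 \<le> t"
  shows "E y t + ennreal (exit_rate S r y) * conv (E y) (\<lambda>_. 1) t = 1"
proof -
  let ?e = "exit_rate S r y"
  have "ennreal ?e * conv (E y) (\<lambda>_. 1) t = (\<integral>\<^sup>+ s. ennreal (?e * exp (- ?e * s)) * indicator {0..t} s \<partial>lborel)"
    unfolding conv_def
    by (subst nn_integral_cmult[symmetric]) (auto simp: ennreal_mult' exit_rate_nonneg mult_ac)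
  also have "\<dots> = ennreal (- exp (- ?e * t) - - exp (- ?e * 0))"
    by (rule nn_integral_FTC_Icc)
       (auto intro!: derivative_eq_intros assms simp: exit_rate_nonneg)
  finally show ?thesis
    using assms exit_rate_nonneg[of y] by (simp flip: ennreal_plus)
qed

lemma mass_0:
  assumes "x \<in> S" "0 \<le> t"
  shows "(\<integral>\<^sup>+ y. J 0 x y t \<partial>count_space S) + overshoot 0 x t = 1"
proof -
  have "(\<integral>\<^sup>+ y. J 0 x y t \<partial>count_space S) = E x t"
    by (subst nn_integral_single[of x]) (auto simp: assms)
  moreover have "overshoot 0 x t = ennreal (exit_rate S r x) * conv (E x) (\<lambda>_. 1) t"
    unfolding overshoot_def J_0_eq by (subst nn_integral_single[of x]) (auto simp: assms)
  ultimately show ?thesis using exp_conv[OF assms(2)] by simp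
qed

text \<open>
  More than \<open>m\<close> jumps means either exactly \<open>m + 1\<close> or more than \<open>m + 1\<close>. Splitting off the last
  jump reduces this to the two possibilities in \<open>exp_conv\<close> for the holding time after it. The
  additive form avoids subtraction in the extended reals.
\<close>

lemma mass_Suc:
  assumes "x \<in> S" "0 \<le> t"
  shows "(\<integral>\<^sup>+ y. J (Suc m) x y t \<partial>count_space S) + overshoot (Suc m) x t = overshoot m x t"
proof -
  let ?e = "\<lambda>y. ennreal (exit_rate S r y)"
  have *: "J (Suc m) x y t + ?e y * conv (J (Suc m) x y) (\<lambda>_. 1) t =
      (\<integral>\<^sup>+ z. R z y * conv (J m x z) (\<lambda>_. 1) t \<partial>count_space S)" if y: "y \<in> S" for y
  proof -
    have "?e y * conv (J (Suc m) x y) (\<lambda>_. 1) t =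
        ?e y * conv (\<lambda>t. \<integral>\<^sup>+ z. R z y * conv (J m x z) (E y) t \<partial>count_space S) (\<lambda>_. 1) t"
      by (simp only: J_last_jump[OF assms(1) y])
    also have "\<dots> = (\<integral>\<^sup>+ z. ?e y * (R z y * conv (J m x z) (conv (E y) (\<lambda>_. 1)) t) \<partial>count_space S)"
      by (simp add: conv_sum_left[OF countable_S] conv_cmult_left conv_assoc nn_integral_cmult)
    also have "\<dots> = (\<integral>\<^sup>+ z. R z y * conv (J m x z) (\<lambda>s. ?e y * conv (E y) (\<lambda>_. 1) s) t \<partial>count_space S)"
      by (simp add: conv_cmult_right mult.left_commute)
    finally have "J (Suc m) x y t + ?e y * conv (J (Suc m) x y) (\<lambda>_. 1) t =
       (\<integral>\<^sup>+ z. R z y * (conv (J m x z) (E y) t + conv (J m x z) (\<lambda>s. ?e y * conv (E y) (\<lambda>_. 1) s) t) \<partial>count_space S)"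
      unfolding J_last_jump[OF assms(1) y] by (simp add: nn_integral_add distrib_left)
    also have "\<dots> = (\<integral>\<^sup>+ z. R z y * conv (J m x z) (\<lambda>s. E y s + ?e y * conv (E y) (\<lambda>_. 1) s) t \<partial>count_space S)"
      by (simp add: conv_add_right)
    also have "\<dots> = (\<integral>\<^sup>+ z. R z y * conv (J m x z) (\<lambda>_. 1) t \<partial>count_space S)"
      by (intro nn_integral_cong arg_cong2[where f="(*)"] conv_cong refl) (rule exp_conv)
    finally show ?thesis .
  qed
  have "(\<integral>\<^sup>+ y. J (Suc m) x y t \<partial>count_space S) + overshoot (Suc m) x t =
     (\<integral>\<^sup>+ y. J (Suc m) x y t + ?e y * conv (J (Suc m) x y) (\<lambda>_. 1) t \<partial>count_space S)"
    unfolding overshoot_def by (rule nn_integral_add[symmetric]) auto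
  also have "\<dots> = (\<integral>\<^sup>+ y. \<integral>\<^sup>+ z. R z y * conv (J m x z) (\<lambda>_. 1) t \<partial>count_space S \<partial>count_space S)"
    by (intro nn_integral_cong) (simp only: * space_count_space)
  also have "\<dots> = (\<integral>\<^sup>+ z. \<integral>\<^sup>+ y. R z y * conv (J m x z) (\<lambda>_. 1) t \<partial>count_space S \<partial>count_space S)"
    by (rule nn_integral_count_space_swap[OF countable_S])
  also have "\<dots> = overshoot m x t"
    unfolding overshoot_def
    by (intro nn_integral_cong) (simp add: nn_integral_multc sum_rates)
  finally show ?thesis .
qed

lemma mass_balance:
  assumes "x \<in> S" "0 \<le> t"
  shows "(\<Sum>k\<le>m. \<integral>\<^sup>+ y. J k x y t \<partial>count_space S) + overshoot m x t = 1"
proof (induction m)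
  case 0 then show ?case using mass_0[OF assms] by simp
next
  case (Suc m)
  then show ?case using mass_Suc[OF assms, of m] by (simp add: add.assoc del: jump_transition.simps)
qed

lemma transition_sum:
  "(\<integral>\<^sup>+ y. transition S r t x y \<partial>count_space S) = (\<Sum>m. \<integral>\<^sup>+ y. J m x y t \<partial>count_space S)"
  unfolding transition_def by (rule nn_integral_suminf) auto

lemma transition_sum_le_1:
  assumes "x \<in> S" "0 \<le> t"
  shows "(\<integral>\<^sup>+ y. transition S r t x y \<partial>count_space S) \<le> 1"
  unfolding transition_sum
proof (rule suminf_le_const)
  show "summable (\<lambda>m. \<integral>\<^sup>+ y. J m x y t \<partial>count_space S)" by simp
  fix m
  have "(\<Sum>k<m. \<integral>\<^sup>+ y. J k x y t \<partial>count_space S) \<le> (\<Sum>k\<le>m. \<integral>\<^sup>+ y. J k x y t \<partial>count_space S)"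
    by (intro sum_mono2) auto
  also have "\<dots> \<le> (\<Sum>k\<le>m. \<integral>\<^sup>+ y. J k x y t \<partial>count_space S) + overshoot m x t"
    by simp
  finally show "(\<Sum>k<m. \<integral>\<^sup>+ y. J k x y t \<partial>count_space S) \<le> 1"
    unfolding mass_balance[OF assms] .
qed

lemma transition_le_1:
  assumes "x \<in> S" "y \<in> S" "0 \<le> t"
  shows "transition S r t x y \<le> 1"
  using nn_integral_ge_point[OF assms(2), of "transition S r t x"]
    transition_sum_le_1[OF assms(1,3)] by (rule order_trans)

lemma measurable_transition [measurable]: "(\<lambda>t. transition S r t x y) \<in> borel_measurable borel"
  unfolding transition_def by measurable

text \<open>
  Detailed balance moves the weight \<open>m\<close> along a path one jump at a time; the reversed path is
  then recognized through its last jump.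
\<close>

lemma J_reversible:
  assumes "\<And>x y. x \<in> S \<Longrightarrow> y \<in> S \<Longrightarrow> m x * R x y = m y * R y x"
    and "x \<in> S" "y \<in> S"
  shows "m x * J k x y t = m y * J k y x t"
  using assms(2,3)
proof (induction k arbitrary: x y t)
  case (Suc k)
  have "m x * J (Suc k) x y t = (\<integral>\<^sup>+ z. m x * R x z * conv (E x) (J k z y) t \<partial>count_space S)"
    unfolding J_first_jump by (simp add: nn_integral_cmult mult.assoc)
  also have "\<dots> = (\<integral>\<^sup>+ z. R z x * conv (E x) (\<lambda>s. m z * J k z y s) t \<partial>count_space S)"
    by (intro nn_integral_cong) (simp add: assms(1) Suc.prems conv_cmult_right mult_ac)
  also have "\<dots> = (\<integral>\<^sup>+ z. R z x * conv (E x) (\<lambda>s. m y * J k y z s) t \<partial>count_space S)"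
    by (intro nn_integral_cong) (simp add: Suc.IH Suc.prems)
  also have "\<dots> = m y * (\<integral>\<^sup>+ z. R z x * conv (J k y z) (E x) t \<partial>count_space S)"
    by (subst conv_commute) (simp_all add: conv_cmult_left nn_integral_cmult mult.left_commute)
  also have "\<dots> = m y * J (Suc k) y x t"
    unfolding J_last_jump[OF Suc.prems(2,1)] ..
  finally show ?case .
qed auto

lemma transition_reversible:
  assumes "\<And>x y. x \<in> S \<Longrightarrow> y \<in> S \<Longrightarrow> m x * R x y = m y * R y x"
    and "x \<in> S" "y \<in> S"
  shows "m x * transition S r t x y = m y * transition S r t y x"
  unfolding transition_def using J_reversible[OF assms, where t=t]
  by (simp flip: ennreal_suminf_cmult)

lemma conv_1_1: "0 \<le> t \<Longrightarrow> conv (\<lambda>_. 1) (\<lambda>_. 1) t = ennreal t"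
  by (simp add: conv_def)

text \<open>
  The sum over \<open>k\<close> is the expected number of jumps during \<open>[0,t]\<close>. By reversibility and
  \<open>transition S r t y x \<le> 1\<close>, at any time the chain started from \<open>x\<close> sits in \<open>y\<close> with probability
  at most \<open>m y / m x\<close>, so that this expectation is at most \<open>t / m x\<close> times the mean jump rate under \<open>m\<close>.
\<close>

lemma overshoot_sum_le:
  assumes rev: "\<And>x y. x \<in> S \<Longrightarrow> y \<in> S \<Longrightarrow> m x * R x y = m y * R y x"
    and x: "x \<in> S" and t: "0 \<le> t"
  shows "m x * (\<Sum>k. overshoot k x t) \<le> (\<integral>\<^sup>+ y. m y * ennreal (exit_rate S r y) \<partial>count_space S) * ennreal t"
proof -
  let ?e = "\<lambda>y. ennreal (exit_rate S r y)"
  have *: "(\<Sum>k. conv (J k x y) (\<lambda>_. 1) t) = conv (\<lambda>t. transition S r t x y) (\<lambda>_. 1) t" for y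
    unfolding conv_def transition_def
    by (subst nn_integral_suminf[symmetric]) auto
  have "m x * (\<Sum>k. overshoot k x t) = m x * (\<integral>\<^sup>+ y. ?e y * (\<Sum>k. conv (J k x y) (\<lambda>_. 1) t) \<partial>count_space S)"
    unfolding overshoot_def by (subst nn_integral_suminf[symmetric]) auto
  also have "\<dots> = (\<integral>\<^sup>+ y. ?e y * conv (\<lambda>t. m x * transition S r t x y) (\<lambda>_. 1) t \<partial>count_space S)"
    unfolding * by (simp add: nn_integral_cmult conv_cmult_left mult.left_commute)
  also have "\<dots> = (\<integral>\<^sup>+ y. ?e y * conv (\<lambda>t. m y * transition S r t y x) (\<lambda>_. 1) t \<partial>count_space S)"
    by (intro nn_integral_cong) (simp add: transition_reversible[OF rev x])
  also have "\<dots> \<le> (\<integral>\<^sup>+ y. ?e y * conv (\<lambda>t. m y * 1) (\<lambda>_. 1) t \<partial>count_space S)"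
    by (intro nn_integral_mono mult_left_mono conv_mono transition_le_1) (auto simp: x)
  also have "\<dots> = (\<integral>\<^sup>+ y. m y * ?e y * ennreal t \<partial>count_space S)"
    by (simp only: conv_cmult_left borel_measurable_const conv_1_1[OF t]) (simp add: mult_ac)
  also have "\<dots> = (\<integral>\<^sup>+ y. m y * ?e y \<partial>count_space S) * ennreal t"
    by (simp add: nn_integral_multc)
  finally show ?thesis .
qed

text \<open>
  Absence of explosion. If mass were missing, each \<open>overshoot k x t\<close> would be at least the same
  positive constant, and the expected number of jumps would be infinite.
\<close>

lemma transition_sum_eq_1:
  assumes rev: "\<And>x y. x \<in> S \<Longrightarrow> y \<in> S \<Longrightarrow> m x * R x y = m y * R y x"
    and fin: "(\<integral>\<^sup>+ y. m y * ennreal (exit_rate S r y) \<partial>count_space S) < \<infinity>"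
    and x: "x \<in> S" and t: "0 \<le> t" and pos: "m x \<noteq> 0"
  shows "(\<integral>\<^sup>+ y. transition S r t x y \<partial>count_space S) = 1"
proof (rule ccontr)
  let ?T = "\<integral>\<^sup>+ y. transition S r t x y \<partial>count_space S"
  assume "?T \<noteq> 1"
  then have "?T < 1" using transition_sum_le_1[OF x t] by simp
  have "1 - ?T \<le> overshoot k x t" for k
  proof -
    have "1 \<le> ?T + overshoot k x t"
      unfolding transition_sum mass_balance[OF x t, of k, symmetric]
      by (intro add_right_mono sum_le_suminf) auto
    then show ?thesis by (simp add: ennreal_minus_le_iff)
  qed
  then have "(\<Sum>k::nat. 1 - ?T) \<le> (\<Sum>k. overshoot k x t)"
    by (intro suminf_le) auto
  moreover have "(\<Sum>k::nat. 1 - ?T) = \<infinity>"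
    using diff_gr0_ennreal[OF \<open>?T < 1\<close>]
    by (simp flip: nn_integral_count_space_nat add: ennreal_mult_top)
  ultimately have "m x * (\<Sum>k. overshoot k x t) = \<infinity>"
    using pos by (simp add: ennreal_mult_top top_unique)
  moreover have "m x * (\<Sum>k. overshoot k x t) < \<infinity>"
  proof (rule le_less_trans)
    show "m x * (\<Sum>k. overshoot k x t) \<le>
        (\<integral>\<^sup>+ y. m y * ennreal (exit_rate S r y) \<partial>count_space S) * ennreal t"
      by (rule overshoot_sum_le[OF rev x t])
    show "\<dots> < \<infinity>" using fin by (simp add: ennreal_mult_less_top)
  qed
  ultimately show False by simp
qed

text \<open>
  By reversibility, the mass flowing into \<open>y\<close> is \<open>m y\<close> times the total mass of the
  chain started from \<open>y\<close>, which is 1 in the absence of explosion.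
\<close>

lemma reversible_imp_stationary:
  assumes rev: "\<And>x y. x \<in> S \<Longrightarrow> y \<in> S \<Longrightarrow> m x * R x y = m y * R y x"
    and fin: "(\<integral>\<^sup>+ y. m y * ennreal (exit_rate S r y) \<partial>count_space S) < \<infinity>"
    and y: "y \<in> S" and t: "0 \<le> t"
  shows "(\<integral>\<^sup>+ x. m x * transition S r t x y \<partial>count_space S) = m y"
proof -
  have "(\<integral>\<^sup>+ x. m x * transition S r t x y \<partial>count_space S) =
      (\<integral>\<^sup>+ x. m y * transition S r t y x \<partial>count_space S)"
    by (intro nn_integral_cong) (simp add: transition_reversible[OF rev _ y])
  also have "\<dots> = m y * (\<integral>\<^sup>+ x. transition S r t y x \<partial>count_space S)"
    by (simp add: nn_integral_cmult)
  also have "\<dots> = m y"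
    using transition_sum_eq_1[OF rev fin y t] by (cases "m y = 0") auto
  finally show ?thesis .
qed

text \<open>
  It suffices to consider paths with a single jump.
\<close>

lemma transition_pos:
  assumes "x \<in> S" "y \<in> S" "r x y > 0" "0 < t"
  shows "transition S r t x y > 0"
proof -
  let ?e = "exit_rate S r"
  let ?c = "ennreal (exp (- ?e x * t)) * ennreal (exp (- ?e y * t))"
  have "0 < R x y * (?c * ennreal t)"
    using assms by (simp add: ennreal_zero_less_mult_iff)
  also have "?c * ennreal t = conv (\<lambda>_. ennreal (exp (- ?e x * t))) (\<lambda>_. ennreal (exp (- ?e y * t))) t"
    unfolding conv_def using assms(4) by (simp add: nn_integral_cmult)
  also have "\<dots> \<le> conv (E x) (J 0 y y) t"
    by (rule conv_mono) (auto intro!: ennreal_leI mult_left_mono_neg simp: exit_rate_nonneg mult_left_mono)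
  also have "R x y * \<dots> \<le> J (Suc 0) x y t"
    unfolding J_first_jump by (rule nn_integral_ge_point[OF assms(2)])
  also have "\<dots> \<le> transition S r t x y"
    unfolding transition_def
    using sum_le_suminf[of "\<lambda>m. J m x y t" "{Suc 0}"] by (simp del: jump_transition.simps)
  finally show ?thesis by (simp add: mult_left_mono)
qed

end

section \<open>Configurations with finitely many defects\<close>

definition step :: "int \<Rightarrow> config" where "step n = (\<lambda>i. i > n)"

definition defects :: "config \<Rightarrow> int set" where "defects a = {i. a i \<noteq> (i > 0)}"

lemma infsum_of_bool_enat:
  "(\<Sum>\<^sub>\<infinity>i\<in>A. of_bool (P i) :: enat) = (if finite {i\<in>A. P i} then enat (card {i\<in>A. P i}) else \<infinity>)"
proof -
  have "(\<Sum>\<^sub>\<infinity>i\<in>A. of_bool (P i) :: enat) = (\<Sum>\<^sub>\<infinity>i\<in>{i\<in>A. P i}. 1)"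
    by (rule infsum_cong_neutral) auto
  also have "\<dots> = (if finite {i\<in>A. P i} then enat (card {i\<in>A. P i}) else \<infinity>)"
    using infsum_superconst_infinite_enat[of "{i\<in>A. P i}" 1 "\<lambda>_. 1"]
    by (auto simp: of_nat_eq_enat)
  finally show ?thesis .
qed

lemma N_p_eq: "N_p a = (if finite {i. i \<le> 0 \<and> a i} then enat (card {i. i \<le> 0 \<and> a i}) else \<infinity>)"
  unfolding N_p_def infsum_of_bool_enat by simp

lemma N_h_eq: "N_h a = (if finite {i. 1 \<le> i \<and> \<not> a i} then enat (card {i. 1 \<le> i \<and> \<not> a i}) else \<infinity>)"
proof -
  have "N_h a = (\<Sum>\<^sub>\<infinity>i\<in>{1..}. of_bool (\<not> a i))"
    unfolding N_h_def by (rule infsum_cong) (auto simp: one_enat_def zero_enat_def)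
  then show ?thesis unfolding infsum_of_bool_enat by simp
qed

lemma defects_eq: "defects a = {i. i \<le> 0 \<and> a i} \<union> {i. 1 \<le> i \<and> \<not> a i}"
  unfolding defects_def by auto

lemma H_iff: "a \<in> H \<longleftrightarrow> finite (defects a)"
  unfolding H_def N_p_eq N_h_eq defects_eq by auto

lemma N_eq: "a \<in> H \<Longrightarrow> N a = int (card {i. 1 \<le> i \<and> \<not> a i}) - int (card {i. i \<le> 0 \<and> a i})"
  unfolding N_def N_p_eq N_h_eq H_iff defects_eq by auto

lemma countable_H: "countable H"
proof -
  have "inj defects" unfolding inj_def defects_def fun_eq_iff set_eq_iff by blast
  then have "inj_on defects H" by (rule inj_on_subset) simp
  moreover have "countable (defects ` H)"
    by (rule countable_subset[OF _ countable_Collect_finite]) (auto simp: H_iff)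
  ultimately show ?thesis by (rule countable_image_inj_on[rotated])
qed

lemma upd_in_H: "a \<in> H \<Longrightarrow> a(i := v) \<in> H"
  unfolding H_iff by (rule finite_subset[of _ "insert i (defects a)"]) (auto simp: defects_def)

lemma N_add_particle:
  assumes "a \<in> H" "\<not> a i"
  shows "N (a(i := True)) = N a - 1"
proof -
  have fin: "finite {j. 1 \<le> j \<and> \<not> a j}" "finite {j. j \<le> 0 \<and> a j}"
    using assms(1) unfolding H_iff defects_eq by auto
  show ?thesis
  proof (cases "i \<ge> 1")
    case True
    have "{j. 1 \<le> j \<and> \<not> a j} = insert i {j. 1 \<le> j \<and> \<not> (a(i := True)) j}"
      using True assms(2) by auto
    moreover have "{j. j \<le> 0 \<and> (a(i := True)) j} = {j. j \<le> 0 \<and> a j}"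
      using True by auto
    moreover have "finite {j. 1 \<le> j \<and> \<not> (a(i := True)) j}"
      by (rule finite_subset[OF _ fin(1)]) auto
    ultimately show ?thesis
      unfolding N_eq[OF assms(1)] N_eq[OF upd_in_H[OF assms(1)]] by simp
  next
    case False
    have "{j. j \<le> 0 \<and> (a(i := True)) j} = insert i {j. j \<le> 0 \<and> a j}"
      using False assms(2) by auto
    moreover have "{j. 1 \<le> j \<and> \<not> (a(i := True)) j} = {j. 1 \<le> j \<and> \<not> a j}"
      using False by auto
    ultimately show ?thesis
      unfolding N_eq[OF assms(1)] N_eq[OF upd_in_H[OF assms(1)]] using fin assms(2) by simp
  qed
qed

lemma N_remove_particle:
  assumes "a \<in> H" "a i"
  shows "N (a(i := False)) = N a + 1"
proof -
  have "(a(i := False))(i := True) = a" using assms(2) by (auto simp: fun_eq_iff)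
  then show ?thesis using N_add_particle[of "a(i := False)" i] upd_in_H[OF assms(1)] by simp
qed

lemma step_0_in_H: "step 0 \<in> H"
  by (simp add: H_iff step_def defects_def)

text \<open>
  Every configuration in \<open>H\<close> arises from \<open>step 0\<close> by finitely many insertions and removals of
  particles. Identities for the blocking measure are proved along these one-site changes, which
  avoids any evaluation of the infinite products of normalizing constants.
\<close>

lemma H_induct [consumes 1, case_names step0 add remove]:
  assumes "a \<in> H" and step0: "P (step 0)"
    and add: "\<And>a i. a \<in> H \<Longrightarrow> \<not> a i \<Longrightarrow> P a \<Longrightarrow> P (a(i := True))"
    and remove: "\<And>a i. a \<in> H \<Longrightarrow> a i \<Longrightarrow> P a \<Longrightarrow> P (a(i := False))"
  shows "P a"
proof -
  have "P a" if "finite D" "defects a = D" for D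
    using that
  proof (induction D arbitrary: a rule: finite_induct)
    case empty
    then have "a = step 0" by (auto simp: defects_def step_def)
    then show ?case using step0 by simp
  next
    case (insert i D)
    define b where "b = a(i := (i > 0))"
    have "defects b = D" using insert(2,4) by (auto simp: b_def defects_def)
    then have b: "P b" "b \<in> H" using insert(1,3) by (simp_all add: H_iff)
    have ai: "a i = (\<not> i > 0)" using insert(4) by (auto simp: defects_def)
    have "a = b(i := a i)" by (auto simp: b_def)
    moreover have "P (b(i := a i))"
    proof (cases "i > 0")
      case True
      then have "b i" "\<not> a i" using ai by (simp_all add: b_def)
      then show ?thesis using remove[OF b(2) _ b(1)] by simp
    next
      case False
      then have "\<not> b i" "a i" using ai by (simp_all add: b_def)
      then show ?thesis using add[OF b(2) _ b(1)] by simp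
    qed
    ultimately show ?case by simp
  qed
  then show ?thesis using assms(1) by (simp add: H_iff)
qed

subsection \<open>Translation\<close>

definition shift :: "config \<Rightarrow> config" where "shift a = (\<lambda>i. a (i - 1))"

lemma shift_upd: "shift (a(i := v)) = (shift a)(i + 1 := v)"
  unfolding shift_def by auto

lemma shift_step: "shift (step n) = step (n + 1)"
  unfolding shift_def step_def by auto

lemma step_Suc: "step (n + 1) = (step n)(n + 1 := False)"
  by (auto simp: step_def fun_eq_iff)

lemma N_step_0: "N (step 0) = 0"
proof -
  have "{i::int. 1 \<le> i \<and> \<not> 0 < i} = {}" "{i::int. i \<le> 0 \<and> 0 < i} = {}" by auto
  then show ?thesis using N_eq[OF step_0_in_H] by (simp only: step_def card.empty)
qed

lemma shift_N: "a \<in> H \<Longrightarrow> shift a \<in> H \<and> N (shift a) = N a + 1"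
proof (induction a rule: H_induct)
  case step0
  have "step (0 + 1) \<in> H" "N (step (0 + 1)) = N (step 0) + 1"
    unfolding step_Suc
    by (auto intro!: upd_in_H step_0_in_H N_remove_particle) (simp add: step_def)
  then show ?case by (simp add: shift_step)
next
  case (add a i)
  then have s: "shift a \<in> H" "N (shift a) = N a + 1" "\<not> shift a (i + 1)"
    by (auto simp: shift_def[of a])
  show ?case
    unfolding shift_upd N_add_particle[OF s(1,3)] N_add_particle[OF add(1,2)]
    by (simp only: s(2) upd_in_H[OF s(1)]) simp
next
  case (remove a i)
  then have s: "shift a \<in> H" "N (shift a) = N a + 1" "shift a (i + 1)"
    by (auto simp: shift_def[of a])
  show ?case
    unfolding shift_upd N_remove_particle[OF s(1,3)] N_remove_particle[OF remove(1,2)]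
    by (simp only: s(2) upd_in_H[OF s(1)])
qed

lemma shift_in_H_iff: "shift a \<in> H \<longleftrightarrow> a \<in> H"
proof
  assume "shift a \<in> H"
  have "defects a \<subseteq> insert 0 ((\<lambda>i. i - 1) ` defects (shift a))"
  proof
    fix i assume "i \<in> defects a"
    then have "i = 0 \<or> i + 1 \<in> defects (shift a)" by (auto simp: defects_def shift_def)
    then show "i \<in> insert 0 ((\<lambda>i. i - 1) ` defects (shift a))" by force
  qed
  then show "a \<in> H" using \<open>shift a \<in> H\<close> unfolding H_iff by (rule finite_subset[OF _ finite.insertI[OF finite_imageI]])
qed (simp add: shift_N)

text \<open>
  Translation relates the levels, so the unknown mass of one level determines all others.
\<close>

lemma bij_shift: "bij_betw shift (H_level n) (H_level (n + 1))"
proof (rule bij_betwI[where g="\<lambda>b i. b (i + 1)"])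
  show "shift \<in> H_level n \<rightarrow> H_level (n + 1)" by (auto simp: H_level_def shift_N)
  show "(\<lambda>b i. b (i + 1)) \<in> H_level (n + 1) \<rightarrow> H_level n"
  proof
    fix b :: config assume b: "b \<in> H_level (n + 1)"
    have "shift (\<lambda>i. b (i + 1)) = b" by (simp add: shift_def)
    then show "(\<lambda>i. b (i + 1)) \<in> H_level n"
      using b shift_N[of "\<lambda>i. b (i + 1)"] shift_in_H_iff[of "\<lambda>i. b (i + 1)"] by (auto simp: H_level_def)
  qed
qed (auto simp: shift_def)

lemma step_in_H_level: "step n \<in> H_level n"
proof (induction n rule: int_induct[where k=0])
  case base then show ?case by (simp add: H_level_def step_0_in_H N_step_0)
next
  case (step1 n) then show ?case using shift_N[of "step n"] by (auto simp: H_level_def shift_step)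
next
  case (step2 n)
  then show ?case
    using shift_N[of "step (n - 1)"] shift_in_H_iff[of "step (n - 1)"] by (auto simp: H_level_def shift_step)
qed

subsection \<open>Connectedness of the levels\<close>

definition hop_right :: "config \<Rightarrow> config \<Rightarrow> bool" where
  "hop_right a b \<longleftrightarrow> (\<exists>i. a i \<and> \<not> a (i + 1) \<and> b = move a i (i + 1))"

text \<open>
  Both configurations of a jump arise from the same \<open>z\<close> by adding one particle, which reduces
  questions about jumps to \<open>N_add_particle\<close> and its analogues.
\<close>

lemma hop_rightE:
  assumes "hop_right a b"
  obtains z i where "\<not> z i" "\<not> z (i + 1)" "a = z(i := True)" "b = z(i + 1 := True)"
proof -
  obtain i where "a i" "\<not> a (i + 1)" "b = move a i (i + 1)" using assms by (auto simp: hop_right_def)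
  then show ?thesis by (intro that[of "a(i := False)" i]) (auto simp: move_def fun_eq_iff)
qed

lemma hop_right_in_H:
  assumes "hop_right a b" shows "a \<in> H \<longleftrightarrow> b \<in> H"
  using assms
proof (rule hop_rightE)
  fix z i assume z: "\<not> z i" "\<not> z (i + 1)" "a = z(i := True)" "b = z(i + 1 := True)"
  then have "z = a(i := False)" "z = b(i + 1 := False)" by (auto simp: fun_eq_iff)
  then show ?thesis using upd_in_H z(3,4) by metis
qed

lemma hop_right_N:
  assumes "hop_right a b" "a \<in> H" shows "N a = N b"
  using assms(1)
proof (rule hop_rightE)
  fix z i assume z: "\<not> z i" "\<not> z (i + 1)" "a = z(i := True)" "b = z(i + 1 := True)"
  then have "z = a(i := False)" by (auto simp: fun_eq_iff)
  then have "z \<in> H" using upd_in_H assms(2) by metis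
  then show ?thesis using z by (simp add: N_add_particle)
qed

lemma hop_right_level: "hop_right a b \<Longrightarrow> a \<in> H_level n \<longleftrightarrow> b \<in> H_level n"
  using hop_right_in_H hop_right_N by (auto simp: H_level_def)

text \<open>
  Decreases by exactly one when a particle jumps to the right, also across the origin.
\<close>

definition energy :: "config \<Rightarrow> nat" where "energy a = (\<Sum>i\<in>defects a. nat \<bar>i\<bar>)"

lemma hop_right_energy:
  assumes "hop_right a b" "a \<in> H"
  shows "energy b < energy a"
proof -
  obtain i where i: "a i" "\<not> a (i + 1)" "b = move a i (i + 1)" using assms(1) by (auto simp: hop_right_def)
  let ?D = "defects a - {i, i + 1}"
  have fin: "finite ?D" using assms(2) by (simp add: H_iff)
  consider "i < 0" | "i = 0" | "i > 0" by linarith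
  then show ?thesis
  proof cases
    case 1
    then have "defects a = insert i ?D" "defects b = insert (i + 1) ?D"
      using i by (auto simp: defects_def move_def)
    moreover have "nat \<bar>i + 1\<bar> < nat \<bar>i\<bar>" using 1 by simp
    ultimately show ?thesis unfolding energy_def
      using fin sum.insert[of ?D i "\<lambda>i. nat \<bar>i\<bar>"] sum.insert[of ?D "i + 1" "\<lambda>i. nat \<bar>i\<bar>"] by simp
  next
    case 2
    then have "defects a = insert 0 (insert 1 ?D)" "defects b = ?D"
      using i by (auto simp: defects_def move_def)
    then show ?thesis unfolding energy_def
      using fin sum.insert[of "insert 1 ?D" 0 "\<lambda>i. nat \<bar>i\<bar>"] sum.insert[of ?D 1 "\<lambda>i. nat \<bar>i\<bar>"] 2 by simp
  next
    case 3
    then have "defects a = insert (i + 1) ?D" "defects b = insert i ?D"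
      using i by (auto simp: defects_def move_def)
    moreover have "nat \<bar>i\<bar> < nat \<bar>i + 1\<bar>" using 3 by simp
    ultimately show ?thesis unfolding energy_def
      using fin sum.insert[of ?D i "\<lambda>i. nat \<bar>i\<bar>"] sum.insert[of ?D "i + 1" "\<lambda>i. nat \<bar>i\<bar>"] by simp
  qed
qed

text \<open>
  Without a particle that has an empty site to its right, \<open>a\<close> is nondecreasing; having
  finitely many defects, it is neither constantly full nor constantly empty.
\<close>

lemma jammed_imp_step:
  assumes "a \<in> H" and "\<And>i. a i \<Longrightarrow> a (i + 1)"
  shows "\<exists>m. a = step m"
proof -
  have up: "a j" if "a i" "i \<le> j" for i j
    using that(2,1) by (induction j rule: int_ge_induct) (auto intro: assms(2))
  have fin: "finite (defects a)" using assms(1) by (simp add: H_iff)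
  \<comment> \<open>Only finitely many positive sites are empty.\<close>
  obtain k where k: "0 < k" "a k"
  proof -
    have "infinite ({0<..} - defects a)" using fin by (simp add: infinite_Ioi Diff_infinite_finite)
    then obtain k where "k \<in> {0<..} - defects a" by (metis finite.emptyI ex_in_conv)
    then show ?thesis by (intro that) (auto simp: defects_def)
  qed
  \<comment> \<open>Only finitely many negative sites are occupied.\<close>
  obtain l where l: "l < 0" "\<not> a l"
  proof -
    have "infinite ({..<0} - defects a)" using fin by (simp add: infinite_Iio Diff_infinite_finite)
    then obtain k where "k \<in> {..<0} - defects a" by (metis finite.emptyI ex_in_conv)
    then show ?thesis by (intro that) (auto simp: defects_def)
  qed
  define m where "m = Max {i \<in> {l..k}. \<not> a i}"
  have m: "m \<in> {i \<in> {l..k}. \<not> a i}" unfolding m_def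
  proof (rule Max_in)
    show "finite {i \<in> {l..k}. \<not> a i}" by (rule finite_subset[of _ "{l..k}"]) auto
    show "{i \<in> {l..k}. \<not> a i} \<noteq> {}" using k l by (intro notI) (auto dest: spec[of _ l])
  qed
  have "m \<noteq> k" using m k by auto
  have "a (m + 1)"
  proof (rule ccontr)
    assume "\<not> a (m + 1)"
    then have "m + 1 \<in> {i \<in> {l..k}. \<not> a i}" using m \<open>m \<noteq> k\<close> by auto
    then have "m + 1 \<le> m" unfolding m_def by (intro Max_ge finite_subset[of "{i \<in> {l..k}. \<not> a i}" "{l..k}"]) auto
    then show False by simp
  qed
  then have "a i \<longleftrightarrow> m < i" for i
    using up[of "m + 1" i] up[of i m] m by force
  then show ?thesis by (intro exI[of _ m]) (auto simp: step_def)
qed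

text \<open>
  Irreducibility of the dynamics on a level: as long as some jump to the right is possible it
  lowers the energy, and the only configuration of the level without such a jump is \<open>step n\<close>.
  The property is required to be preserved in both directions of a jump, because the paths of two
  configurations meet at \<open>step n\<close>.
\<close>

lemma level_connected:
  assumes "\<And>a b. a \<in> H_level n \<Longrightarrow> b \<in> H_level n \<Longrightarrow> hop_right a b \<Longrightarrow> P a \<longleftrightarrow> P b"
    and "a \<in> H_level n"
  shows "P a \<longleftrightarrow> P (step n)"
  using assms(2)
proof (induction "energy a" arbitrary: a rule: less_induct)
  case less
  show ?case
  proof (cases "\<exists>b. hop_right a b")
    case True
    then obtain b where b: "hop_right a b" ..
    then have "b \<in> H_level n" using less.prems hop_right_level by blast
    moreover have "energy b < energy a" using hop_right_energy[OF b] less.prems by (simp add: H_level_def)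
    ultimately show ?thesis using less.hyps assms(1)[OF less.prems _ b] by simp
  next
    case False
    then have "\<And>i. a i \<Longrightarrow> a (i + 1)" by (auto simp: hop_right_def)
    then obtain m where m: "a = step m" using jammed_imp_step less.prems by (auto simp: H_level_def)
    then have "m = n" using less.prems step_in_H_level[of m] by (simp add: H_level_def)
    then show ?thesis using m by simp
  qed
qed

section \<open>Sums over countable index sets\<close>

lemma (in finite_measure) has_sum_disjoint_family:
  fixes F :: "int \<Rightarrow> 'a set"
  assumes "range F \<subseteq> sets M" "disjoint_family F"
  shows "((\<lambda>n. measure M (F n)) has_sum measure M (\<Union>n. F n)) UNIV"
proof -
  have "(\<lambda>k. measure M (F (int_decode k))) sums measure M (\<Union>k. F (int_decode k))"
  proof (rule finite_measure_UNION)
    show "disjoint_family (\<lambda>k. F (int_decode k))"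
      using disjoint_family_onD[OF assms(2)] by (simp add: disjoint_family_on_def int_decode_eq)
  qed (use assms(1) in auto)
  also have "(\<Union>k. F (int_decode k)) = (\<Union>n. F n)"
    using surj_int_decode by (metis image_image)
  finally have "((\<lambda>k. measure M (F (int_decode k))) has_sum measure M (\<Union>n. F n)) UNIV"
    by (rule sums_nonneg_imp_has_sum) simp
  then show ?thesis
    by (subst (asm) has_sum_reindex_bij_betw[OF bij_int_decode])
qed

lemma nn_integral_count_space_le:
  assumes "countable A" "\<And>x. x \<in> A \<Longrightarrow> {x} \<in> sets M"
  shows "(\<integral>\<^sup>+ x. emeasure M {x} * f x \<partial>count_space A) \<le> (\<integral>\<^sup>+ x. f x \<partial>M)"
proof -
  have "(\<integral>\<^sup>+ x. emeasure M {x} * f x \<partial>count_space A) =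
      (\<integral>\<^sup>+ x. \<integral>\<^sup>+ y. f x * indicator {x} y \<partial>M \<partial>count_space A)"
    by (intro nn_integral_cong) (simp add: nn_integral_cmult assms mult.commute)
  also have "\<dots> = (\<integral>\<^sup>+ y. \<integral>\<^sup>+ x. f x * indicator {x} y \<partial>count_space A \<partial>M)"
    by (rule nn_integral_count_space_nn_integral[symmetric]) (use assms in auto)
  also have "\<dots> \<le> (\<integral>\<^sup>+ y. f y \<partial>M)"
  proof (intro nn_integral_mono)
    fix y
    have "(\<integral>\<^sup>+ x. f x * indicator {x} y \<partial>count_space A) = (\<Sum>x\<in>A \<inter> {y}. f x * indicator {x} y)"
      by (rule nn_integral_count_space') auto
    also have "\<dots> \<le> (\<Sum>x\<in>{y}. f x * indicator {x} y)"
      by (rule sum_mono2) auto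
    finally show "(\<integral>\<^sup>+ x. f x * indicator {x} y \<partial>count_space A) \<le> f y" by simp
  qed
  finally show ?thesis .
qed

lemma nn_integral_int_geometric:
  assumes "0 \<le> x" "x < 1"
  shows "(\<integral>\<^sup>+ i. ennreal (x ^ nat \<bar>i\<bar>) \<partial>count_space UNIV) < \<infinity>"
proof -
  have geo: "(\<integral>\<^sup>+ k. ennreal (x ^ k) \<partial>count_space UNIV) < \<infinity>"
    using assms by (simp add: nn_integral_count_space_nat suminf_ennreal2 summable_geometric)
  have "(\<integral>\<^sup>+ i. ennreal (x ^ nat \<bar>i\<bar>) \<partial>count_space UNIV) \<le>
      (\<integral>\<^sup>+ i. ennreal (x ^ nat \<bar>i\<bar>) * indicator {0..} i + ennreal (x ^ nat \<bar>i\<bar>) * indicator {..0} i \<partial>count_space UNIV)"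
    by (intro nn_integral_mono) (auto split: split_indicator)
  also have "\<dots> = (\<integral>\<^sup>+ i. ennreal (x ^ nat \<bar>i\<bar>) \<partial>count_space {0..}) + (\<integral>\<^sup>+ i. ennreal (x ^ nat \<bar>i\<bar>) \<partial>count_space {..0})"
    by (simp add: nn_integral_add nn_integral_count_space_indicator)
  also have "(\<integral>\<^sup>+ i. ennreal (x ^ nat \<bar>i\<bar>) \<partial>count_space {0..}) = (\<integral>\<^sup>+ k. ennreal (x ^ k) \<partial>count_space UNIV)"
  proof -
    have "bij_betw int UNIV {0..}" by (rule bij_betwI[where g=nat]) auto
    from nn_integral_bij_count_space[OF this, of "\<lambda>i. ennreal (x ^ nat \<bar>i\<bar>)"] show ?thesis by simp
  qed
  also have "(\<integral>\<^sup>+ i. ennreal (x ^ nat \<bar>i\<bar>) \<partial>count_space {..0}) = (\<integral>\<^sup>+ k. ennreal (x ^ k) \<partial>count_space UNIV)"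
  proof -
    have "bij_betw (\<lambda>k. - int k) UNIV {..0}" by (rule bij_betwI[where g="\<lambda>i. nat (- i)"]) auto
    from nn_integral_bij_count_space[OF this, of "\<lambda>i. ennreal (x ^ nat \<bar>i\<bar>)"] show ?thesis by simp
  qed
  also have "(\<integral>\<^sup>+ k. ennreal (x ^ k) \<partial>count_space UNIV) + (\<integral>\<^sup>+ k. ennreal (x ^ k) \<partial>count_space UNIV) < \<infinity>"
    using geo by simp
  finally show ?thesis .
qed

lemma ennreal_divide_mult: "(x::ennreal) / z * y = x * y / z"
  using ennreal_times_divide[of y x z] by (simp only: mult.commute)

section \<open>The blocking measure\<close>

locale asep =
  fixes p q c :: real
  assumes p_gt: "1 / 2 < p" and pq: "p = 1 - q" and p_lt: "p < 1"
begin

lemma pq_pos: "0 < p" "0 < q" "p \<noteq> 0" "q \<noteq> 0" and q_less_p: "q < p"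
  using p_gt pq p_lt by auto

text \<open>
  The odds of a particle at site \<open>i\<close>.
\<close>

definition \<theta> :: "int \<Rightarrow> real" where "\<theta> i = exp c * (p / q) powi i"

lemma \<theta>_pos: "\<theta> i > 0"
  using pq_pos by (simp add: \<theta>_def)

lemma \<theta>_Suc: "\<theta> (i + 1) = \<theta> i * (p / q)"
  using pq_pos by (simp add: \<theta>_def power_int_add)

lemma rho_eq: "rho p q c i = \<theta> i / (1 + \<theta> i)"
  by (simp add: rho_def \<theta>_def)

lemma rho_bounds: "0 \<le> rho p q c i" "rho p q c i \<le> 1"
  using \<theta>_pos[of i] by (auto simp: rho_eq divide_simps)

lemma one_minus_rho: "1 - rho p q c i = 1 / (1 + \<theta> i)"
  using \<theta>_pos[of i] by (simp add: rho_eq divide_simps)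

abbreviation \<pi> :: "config measure" where "\<pi> \<equiv> blocking p q c"
abbreviation B :: "int \<Rightarrow> bool measure" where "B i \<equiv> measure_pmf (bernoulli_pmf (rho p q c i))"

sublocale product_prob_space B UNIV
  by unfold_locales

lemma \<pi>_eq: "\<pi> = Pi\<^sub>M UNIV B"
  by (simp add: blocking_def)

sublocale \<pi>: prob_space \<pi>
  unfolding \<pi>_eq by (rule P.prob_space_axioms)

lemma space_\<pi> [simp]: "space \<pi> = UNIV"
  by (simp add: \<pi>_eq space_PiM)

lemma measurable_site [measurable]: "(\<lambda>a. a i) \<in> measurable \<pi> (count_space UNIV)"
  unfolding \<pi>_eq using measurable_component_singleton[of i UNIV B]
  by (simp cong: measurable_cong_sets)

lemma singleton_in_sets: "{a} \<in> sets \<pi>"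
proof -
  have "{b \<in> space \<pi>. \<forall>i. b i = a i} \<in> sets \<pi>" by measurable
  then show ?thesis by (simp add: fun_eq_iff[symmetric])
qed

lemma countable_in_sets: "countable A \<Longrightarrow> A \<in> sets \<pi>"
  by (rule sets.countable) (rule singleton_in_sets)

lemma H_in_sets [measurable]: "H \<in> sets \<pi>"
  by (rule countable_in_sets[OF countable_H])

lemma subset_H_in_sets: "A \<subseteq> H \<Longrightarrow> A \<in> sets \<pi>"
  by (rule countable_in_sets) (rule countable_subset[OF _ countable_H])

lemma H_level_subset: "H_level n \<subseteq> H"
  by (auto simp: H_level_def)

lemma H_level_in_sets [measurable]: "H_level n \<in> sets \<pi>"
  by (rule subset_H_in_sets[OF H_level_subset])

subsection \<open>Weights of single configurations\<close>

lemma measure_cylinder: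
  "measure \<pi> {b. \<forall>i\<in>{-int n..int n}. b i = a i} = (\<Prod>i\<in>{-int n..int n}. pmf (bernoulli_pmf (rho p q c i)) (a i))"
proof -
  have "emeasure \<pi> {b \<in> space \<pi>. \<forall>i\<in>{-int n..int n}. b i \<in> {a i}} = (\<Prod>i\<in>{-int n..int n}. emeasure (B i) {a i})"
    unfolding \<pi>_eq by (rule emeasure_PiM_Collect) auto
  also have "\<dots> = ennreal (\<Prod>i\<in>{-int n..int n}. pmf (bernoulli_pmf (rho p q c i)) (a i))"
    by (simp add: emeasure_pmf_single prod_ennreal)
  finally show ?thesis by (simp add: measure_def prod_nonneg)
qed

lemma measure_singleton_lim:
  "(\<lambda>n. \<Prod>i\<in>{-int n..int n}. pmf (bernoulli_pmf (rho p q c i)) (a i)) \<longlonglongrightarrow> measure \<pi> {a}"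
proof -
  let ?C = "\<lambda>n::nat. {b. \<forall>i\<in>{-int n..int n}. b i = a i}"
  have "{b \<in> space \<pi>. \<forall>i\<in>{-int n..int n}. b i = a i} \<in> sets \<pi>" for n by measurable
  then have "range ?C \<subseteq> sets \<pi>" by auto
  moreover have "decseq ?C" by (auto simp: decseq_def)
  ultimately have "(\<lambda>n. measure \<pi> (?C n)) \<longlonglongrightarrow> measure \<pi> (\<Inter>n. ?C n)"
    by (rule \<pi>.finite_Lim_measure_decseq)
  moreover have "(\<Inter>n. ?C n) = {a}"
  proof
    show "(\<Inter>n. ?C n) \<subseteq> {a}"
    proof
      fix b assume b: "b \<in> (\<Inter>n. ?C n)"
      have "b i = a i" for i
      proof -
        have "i \<in> {- int (nat \<bar>i\<bar>)..int (nat \<bar>i\<bar>)}" by auto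
        then show ?thesis using b by blast
      qed
      then show "b \<in> {a}" by auto
    qed
  qed auto
  ultimately show ?thesis by (simp add: measure_cylinder)
qed

text \<open>
  The measures of both configurations are limits of finite products that differ only in the
  factor of site \<open>i\<close>.
\<close>

lemma measure_add_particle:
  assumes "\<not> a i" shows "measure \<pi> {a(i := True)} = \<theta> i * measure \<pi> {a}"
proof -
  define F where "F n a = (\<Prod>i\<in>{-int n..int n}. pmf (bernoulli_pmf (rho p q c i)) (a i))" for n a
  have "F n (a(i := True)) = \<theta> i * F n a" if n: "n \<ge> nat \<bar>i\<bar>" for n
  proof -
    have i: "i \<in> {-int n..int n}" using n by auto
    have F: "F n b = pmf (bernoulli_pmf (rho p q c i)) (b i) *
        (\<Prod>j\<in>{-int n..int n} - {i}. pmf (bernoulli_pmf (rho p q c j)) (b j))" for b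
      unfolding F_def by (rule prod.remove) (use i in auto)
    have "(\<Prod>j\<in>{-int n..int n} - {i}. pmf (bernoulli_pmf (rho p q c j)) ((a(i := True)) j)) =
        (\<Prod>j\<in>{-int n..int n} - {i}. pmf (bernoulli_pmf (rho p q c j)) (a j))"
      by (rule prod.cong) auto
    moreover have "rho p q c i = \<theta> i * (1 - rho p q c i)"
      unfolding one_minus_rho by (simp add: rho_eq)
    ultimately show ?thesis
      unfolding F[of a] F[of "a(i := True)"] using assms rho_bounds[of i] by simp
  qed
  then have "eventually (\<lambda>n. F n (a(i := True)) = \<theta> i * F n a) sequentially"
    unfolding eventually_sequentially by blast
  moreover have "(\<lambda>n. F n (a(i := True))) \<longlonglongrightarrow> measure \<pi> {a(i := True)}"
    unfolding F_def by (rule measure_singleton_lim)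
  ultimately have "(\<lambda>n. \<theta> i * F n a) \<longlonglongrightarrow> measure \<pi> {a(i := True)}"
    by (rule Lim_transform_eventually[rotated])
  moreover have "(\<lambda>n. \<theta> i * F n a) \<longlonglongrightarrow> \<theta> i * measure \<pi> {a}"
    unfolding F_def by (intro tendsto_mult_left measure_singleton_lim)
  ultimately show ?thesis by (rule LIMSEQ_unique)
qed

lemma measure_remove_particle:
  assumes "a i" shows "measure \<pi> {a(i := False)} = measure \<pi> {a} / \<theta> i"
proof -
  have "(a(i := False))(i := True) = a" using assms by (auto simp: fun_eq_iff)
  then show ?thesis
    using measure_add_particle[of "a(i := False)" i] \<theta>_pos[of i] by simp
qed

text \<open>
  Detailed balance: the odds of neighbouring sites differ by the factor \<open>p / q\<close>.
\<close>

lemma measure_hop_right: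
  assumes "hop_right a b" shows "p * measure \<pi> {a} = q * measure \<pi> {b}"
  using assms
proof (rule hop_rightE)
  fix z i assume "\<not> z i" "\<not> z (i + 1)" "a = z(i := True)" "b = z(i + 1 := True)"
  then show ?thesis using pq_pos by (simp add: measure_add_particle \<theta>_Suc)
qed

text \<open>
  A particle at \<open>i\<close> becomes one at \<open>i + 1\<close>, whose odds are larger by the factor \<open>p / q\<close>;
  this factor is what the change of \<open>N\<close> by one contributes to the power of \<open>q / p\<close>.
\<close>

lemma measure_shift:
  assumes "a \<in> H"
  shows "measure \<pi> {shift a} = exp (- c) * (q / p) powi (N a + 1) * measure \<pi> {a}"
  using assms
proof (induction a rule: H_induct)
  case step0
  have "measure \<pi> {step (0 + 1)} = measure \<pi> {step 0} / \<theta> 1"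
    unfolding step_Suc by (subst measure_remove_particle) (simp_all add: step_def)
  then show ?case using pq_pos by (simp add: shift_step N_step_0 \<theta>_def exp_minus field_simps)
next
  case (add a i)
  then have "\<not> shift a (i + 1)" by (simp add: shift_def)
  then have "measure \<pi> {shift (a(i := True))} = \<theta> (i + 1) * measure \<pi> {shift a}"
    unfolding shift_upd by (rule measure_add_particle)
  also have "\<dots> = exp (- c) * ((q / p) powi (N a + 1) * (p / q)) * measure \<pi> {a(i := True)}"
    unfolding add.IH \<theta>_Suc measure_add_particle[of a i, OF add(2)] by (simp add: mult_ac)
  also have "(q / p) powi (N a + 1) * (p / q) = (q / p) powi (N (a(i := True)) + 1)"
    unfolding N_add_particle[OF add(1,2)] using pq_pos by (simp add: power_int_add)
  finally show ?case .
next
  case (remove a i)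
  then have "shift a (i + 1)" by (simp add: shift_def)
  then have "measure \<pi> {shift (a(i := False))} = measure \<pi> {shift a} / \<theta> (i + 1)"
    unfolding shift_upd by (rule measure_remove_particle)
  also have "\<dots> = exp (- c) * ((q / p) powi (N a + 1) * (q / p)) * measure \<pi> {a(i := False)}"
    unfolding remove.IH \<theta>_Suc measure_remove_particle[of a i, OF remove(2)] by (simp add: mult_ac)
  also have "(q / p) powi (N a + 1) * (q / p) = (q / p) powi (N (a(i := False)) + 1)"
    unfolding N_remove_particle[OF remove(1,2)] using pq_pos power_int_add[of "q / p" "N a + 1" 1] by simp
  finally show ?case .
qed

subsection \<open>Concentration on H\<close>

text \<open>
  A defect is a particle at a site \<open>i \<le> 0\<close> or a hole at a site \<open>i > 0\<close>; in both cases the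
  probability is bounded by the odds of the unlikely value.
\<close>

lemma emeasure_defect: "emeasure \<pi> {a. i \<in> defects a} \<le> ennreal (exp \<bar>c\<bar> * (q / p) ^ nat \<bar>i\<bar>)"
proof -
  have "emeasure \<pi> {a. i \<in> defects a} = emeasure \<pi> {a \<in> space \<pi>. a i \<in> {\<not> i > 0}}"
    by (rule arg_cong2[where f=emeasure]) (auto simp: defects_def)
  also have "\<dots> = emeasure (B i) {\<not> i > 0}"
    unfolding \<pi>_eq by (rule emeasure_PiM_Collect_single) auto
  also have "\<dots> = ennreal (pmf (bernoulli_pmf (rho p q c i)) (\<not> i > 0))"
    by (rule emeasure_pmf_single)
  also have "pmf (bernoulli_pmf (rho p q c i)) (\<not> i > 0) \<le> exp \<bar>c\<bar> * (q / p) ^ nat \<bar>i\<bar>"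
  proof (cases "i > 0")
    case True
    have "pmf (bernoulli_pmf (rho p q c i)) (\<not> i > 0) = 1 / (1 + \<theta> i)"
      using True rho_bounds[of i] one_minus_rho[of i] by simp
    also have "\<dots> \<le> 1 / \<theta> i" using \<theta>_pos[of i] by (simp add: divide_simps)
    also have "\<dots> = exp (- c) * (q / p) ^ nat i"
      using True pq_pos by (simp add: \<theta>_def exp_minus power_int_def field_simps)
    also have "\<dots> \<le> exp \<bar>c\<bar> * (q / p) ^ nat \<bar>i\<bar>"
      using True pq_pos by (intro mult_mono) auto
    finally show ?thesis .
  next
    case False
    have "pmf (bernoulli_pmf (rho p q c i)) (\<not> i > 0) = \<theta> i / (1 + \<theta> i)"
      using False rho_bounds[of i] by (simp add: rho_eq)
    also have "\<dots> \<le> \<theta> i" using \<theta>_pos[of i] by (simp add: divide_simps)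
    also have "\<dots> = exp c * (q / p) ^ nat (- i)"
      using False pq_pos by (simp add: \<theta>_def power_int_def field_simps)
    also have "\<dots> \<le> exp \<bar>c\<bar> * (q / p) ^ nat \<bar>i\<bar>"
      using False pq_pos by (intro mult_mono) auto
    finally show ?thesis .
  qed
  finally show ?thesis by (simp add: ennreal_leI)
qed

definition defect_count :: "config \<Rightarrow> ennreal" where
  "defect_count a = (\<integral>\<^sup>+ i. indicator (defects a) i \<partial>count_space UNIV)"

lemma defect_measurable [measurable]: "{a. i \<in> defects a} \<in> sets \<pi>"
proof -
  have "{a \<in> space \<pi>. a i \<noteq> (i > 0)} \<in> sets \<pi>" by measurable
  then show ?thesis by (simp add: defects_def)
qed

lemma indicator_defects: "indicator (defects a) i = indicator {a. i \<in> defects a} a"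
  by (simp add: indicator_def)

lemma measurable_defect_count [measurable]: "defect_count \<in> borel_measurable \<pi>"
  unfolding defect_count_def[abs_def] indicator_defects
  by (rule borel_measurable_nn_integral_count_space) (simp, measurable)

text \<open>
  This finite expectation serves twice: it makes \<open>H\<close> a set of full measure, and it bounds the
  total jump rate, which is needed to exclude explosion.
\<close>

lemma defect_count_integral: "(\<integral>\<^sup>+ a. defect_count a \<partial>\<pi>) < \<infinity>"
proof -
  have "(\<integral>\<^sup>+ a. defect_count a \<partial>\<pi>) = (\<integral>\<^sup>+ i. emeasure \<pi> {a. i \<in> defects a} \<partial>count_space UNIV)"
    unfolding defect_count_def indicator_defects
    by (subst nn_integral_count_space_nn_integral) (auto simp: defect_measurable)
  also have "\<dots> \<le> (\<integral>\<^sup>+ i. ennreal (exp \<bar>c\<bar>) * ennreal ((q / p) ^ nat \<bar>i\<bar>) \<partial>count_space UNIV)"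
    using emeasure_defect pq_pos by (intro nn_integral_mono) (simp add: ennreal_mult')
  also have "\<dots> = ennreal (exp \<bar>c\<bar>) * (\<integral>\<^sup>+ i. ennreal ((q / p) ^ nat \<bar>i\<bar>) \<partial>count_space UNIV)"
    by (rule nn_integral_cmult) simp
  also have "\<dots> < \<infinity>"
    using nn_integral_int_geometric[of "q / p"] pq_pos q_less_p by (simp add: ennreal_mult_less_top)
  finally show ?thesis .
qed

lemma defect_count_eq: "a \<in> H \<Longrightarrow> defect_count a = of_nat (card (defects a))"
  by (simp add: defect_count_def H_iff)

lemma AE_H: "AE a in \<pi>. a \<in> H"
proof -
  have "AE a in \<pi>. defect_count a \<noteq> \<infinity>"
    using defect_count_integral by (intro nn_integral_PInf_AE) auto
  then show ?thesis
    by eventually_elim (auto simp: defect_count_def H_iff emeasure_count_space split: if_splits)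
qed

subsection \<open>The distribution of N\<close>

lemma measure_level_Suc:
  "measure \<pi> (H_level (n + 1)) = exp (- c) * (q / p) powi (n + 1) * measure \<pi> (H_level n)"
proof -
  let ?w = "exp (- c) * (q / p) powi (n + 1)"
  have w: "?w \<ge> 0" using pq_pos by simp
  have cnt: "countable (H_level n)" for n by (rule countable_subset[OF H_level_subset countable_H])
  have "emeasure \<pi> (H_level (n + 1)) = (\<integral>\<^sup>+ b. emeasure \<pi> {b} \<partial>count_space (H_level (n + 1)))"
    by (rule emeasure_countable_singleton[OF singleton_in_sets cnt])
  also have "\<dots> = (\<integral>\<^sup>+ a. emeasure \<pi> {shift a} \<partial>count_space (H_level n))"
    by (rule nn_integral_bij_count_space[OF bij_shift, symmetric])
  also have "\<dots> = (\<integral>\<^sup>+ a. ennreal ?w * emeasure \<pi> {a} \<partial>count_space (H_level n))"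
  proof (rule nn_integral_cong)
    fix a assume "a \<in> space (count_space (H_level n))"
    then have "a \<in> H" "N a = n" by (auto simp: H_level_def)
    then show "emeasure \<pi> {shift a} = ennreal ?w * emeasure \<pi> {a}"
      using measure_shift[of a] w by (simp add: \<pi>.emeasure_eq_measure ennreal_mult)
  qed
  also have "\<dots> = ennreal ?w * emeasure \<pi> (H_level n)"
    by (simp add: nn_integral_cmult emeasure_countable_singleton[OF singleton_in_sets cnt, symmetric])
  also have "\<dots> = ennreal (?w * measure \<pi> (H_level n))"
    using w by (simp add: \<pi>.emeasure_eq_measure ennreal_mult)
  finally show ?thesis
    using w by (simp add: \<pi>.emeasure_eq_measure)
qed

text \<open>
  The summand of \<open>K p q c\<close>.
\<close>

definition level_weight :: "int \<Rightarrow> real" where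
  "level_weight n = (q / p) powr ((real_of_int n ^ 2 + real_of_int n) / 2) * exp (- c * real_of_int n)"

lemma level_weight_pos: "level_weight n > 0" and level_weight_0: "level_weight 0 = 1"
  using pq_pos by (auto simp: level_weight_def)

lemma level_weight_Suc: "level_weight (n + 1) = exp (- c) * (q / p) powi (n + 1) * level_weight n"
proof -
  have "(real_of_int (n + 1) ^ 2 + real_of_int (n + 1)) / 2 = (real_of_int n ^ 2 + real_of_int n) / 2 + real_of_int (n + 1)"
    by (simp add: power2_eq_square algebra_simps add_divide_distrib)
  moreover have "exp (- c * real_of_int (n + 1)) = exp (- c * real_of_int n) * exp (- c)"
    by (simp add: algebra_simps flip: exp_add)
  moreover have "(q / p) powr real_of_int (n + 1) = (q / p) powi (n + 1)"
    using pq_pos by (intro powr_real_of_int') auto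
  ultimately show ?thesis unfolding level_weight_def by (simp only: powr_add mult_ac)
qed

lemma measure_level: "measure \<pi> (H_level n) = level_weight n * measure \<pi> (H_level 0)"
proof (induction n rule: int_induct[where k=0])
  case base then show ?case by (simp add: level_weight_0)
next
  case (step1 n) then show ?case by (simp add: measure_level_Suc level_weight_Suc)
next
  case (step2 n)
  define e where "e = exp (- c) * (q / p) powi n"
  have "e \<noteq> 0" using pq_pos by (simp add: e_def)
  moreover have "measure \<pi> (H_level n) = e * measure \<pi> (H_level (n - 1))" "level_weight n = e * level_weight (n - 1)"
    using measure_level_Suc[of "n - 1"] level_weight_Suc[of "n - 1"] by (simp_all add: e_def)
  ultimately show ?case using step2(2) by (simp add: mult.assoc)
qed

lemma has_sum_levels:
  assumes "A \<in> sets \<pi>"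
  shows "((\<lambda>n. measure \<pi> (H_level n \<inter> A)) has_sum measure \<pi> A) UNIV"
proof -
  have "((\<lambda>n. measure \<pi> (H_level n \<inter> A)) has_sum measure \<pi> (\<Union>n. H_level n \<inter> A)) UNIV"
  proof (rule \<pi>.has_sum_disjoint_family)
    show "range (\<lambda>n. H_level n \<inter> A) \<subseteq> sets \<pi>" using assms by auto
    show "disjoint_family (\<lambda>n. H_level n \<inter> A)" by (auto simp: disjoint_family_on_def H_level_def)
  qed
  also have "(\<Union>n. H_level n \<inter> A) = H \<inter> A" by (auto simp: H_level_def)
  also have "measure \<pi> (H \<inter> A) = measure \<pi> A"
    by (rule \<pi>.finite_measure_eq_AE) (use AE_H assms in auto)
  finally show ?thesis .
qed

lemma measure_level_0: "measure \<pi> (H_level 0) * K p q c = 1"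
proof -
  have "((\<lambda>n. level_weight n * measure \<pi> (H_level 0)) has_sum 1) UNIV"
    using has_sum_levels[of "space \<pi>"] sets.top[of \<pi>] \<pi>.prob_space by (simp add: measure_level[symmetric])
  then have "(\<Sum>\<^sub>\<infinity>n. level_weight n * measure \<pi> (H_level 0)) = 1"
    by (rule infsumI)
  moreover have "measure \<pi> (H_level 0) \<noteq> 0"
    using calculation by auto
  ultimately show ?thesis
    by (simp add: infsum_cmult_left' infsum_cmult_right' K_def level_weight_def mult.commute)
qed

lemma measure_level_eq_weight: "measure \<pi> (H_level n) = weight p q c n"
proof -
  have "measure \<pi> (H_level 0) = 1 / K p q c"
    using measure_level_0 by (cases "K p q c = 0") (auto simp: eq_divide_eq)
  then show ?thesis unfolding measure_level[of n] by (simp add: weight_def level_weight_def)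
qed

lemma measure_level_pos: "measure \<pi> (H_level n) > 0"
proof -
  have "measure \<pi> (H_level 0) \<noteq> 0" using measure_level_0 by auto
  then have "measure \<pi> (H_level 0) > 0" by (simp add: zero_less_measure_iff)
  then show ?thesis unfolding measure_level[of n] using level_weight_pos by simp
qed

text \<open>
  Changing one site multiplies the measure by a positive factor, so either all singletons of \<open>H\<close>
  are null or none is; the former is impossible for a countable set of full measure.
\<close>

lemma measure_singleton_pos:
  assumes "a \<in> H" shows "measure \<pi> {a} > 0"
proof -
  have eq: "measure \<pi> {a} = 0 \<longleftrightarrow> measure \<pi> {step 0} = 0" if "a \<in> H" for a
    using that
  proof (induction a rule: H_induct)
    case (add a i)
    show ?case unfolding measure_add_particle[of a i, OF add(2)] using add(3) \<theta>_pos[of i] by simp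
  next
    case (remove a i)
    show ?case unfolding measure_remove_particle[of a i, OF remove(2)] using remove(3) \<theta>_pos[of i] by simp
  qed simp
  have "measure \<pi> {step 0} \<noteq> 0"
  proof
    assume "measure \<pi> {step 0} = 0"
    then have "emeasure \<pi> {a} = 0" if "a \<in> H" for a
      using eq[OF that] by (simp add: \<pi>.emeasure_eq_measure)
    then have "emeasure \<pi> H = 0"
      by (subst emeasure_countable_singleton[OF singleton_in_sets countable_H])
         (simp add: nn_integral_0_iff_AE AE_count_space)
    then show False using \<pi>.emeasure_eq_1_AE[OF H_in_sets AE_H] by simp
  qed
  then show ?thesis using eq[OF assms] by (simp add: zero_less_measure_iff)
qed

section \<open>Stationarity and ergodicity\<close>

lemma asep_rate_eq:
  "asep_rate p q a b = (if hop_right a b then p else 0) + (if hop_right b a then q else 0)"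
proof -
  have "(\<exists>i. a i \<and> \<not> a (i - 1) \<and> b = move a i (i - 1)) \<longleftrightarrow> hop_right b a"
  proof
    assume "\<exists>i. a i \<and> \<not> a (i - 1) \<and> b = move a i (i - 1)"
    then obtain i where "a i" "\<not> a (i - 1)" "b = move a i (i - 1)" by blast
    then show "hop_right b a"
      unfolding hop_right_def by (intro exI[of _ "i - 1"]) (auto simp: move_def fun_eq_iff)
  next
    assume "hop_right b a"
    then obtain i where "b i" "\<not> b (i + 1)" "a = move b i (i + 1)" by (auto simp: hop_right_def)
    then show "\<exists>i. a i \<and> \<not> a (i - 1) \<and> b = move a i (i - 1)"
      by (intro exI[of _ "i + 1"]) (auto simp: move_def fun_eq_iff)
  qed
  then show ?thesis by (simp add: asep_rate_def hop_right_def)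
qed

lemma asep_rate_nonneg: "asep_rate p q a b \<ge> 0" and asep_rate_le_1: "asep_rate p q a b \<le> 1"
proof -
  have "p + q = 1" using pq by simp
  then show "asep_rate p q a b \<ge> 0" "asep_rate p q a b \<le> 1"
    using pq_pos by (simp_all add: asep_rate_eq)
qed

lemma targets_subset:
  "{b \<in> H. asep_rate p q a b \<noteq> 0} \<subseteq> (\<lambda>i. a(i := a (i + 1), i + 1 := a i)) ` {i. a i \<noteq> a (i + 1)}"
proof
  fix b assume "b \<in> {b \<in> H. asep_rate p q a b \<noteq> 0}"
  then consider "hop_right a b" | "hop_right b a" by (auto simp: asep_rate_eq split: if_splits)
  then show "b \<in> (\<lambda>i. a(i := a (i + 1), i + 1 := a i)) ` {i. a i \<noteq> a (i + 1)}"
  proof cases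
    case 1
    then obtain i where "a i" "\<not> a (i + 1)" "b = move a i (i + 1)" by (auto simp: hop_right_def)
    then show ?thesis by (intro image_eqI[of _ _ i]) (auto simp: move_def fun_eq_iff)
  next
    case 2
    then obtain i where "b i" "\<not> b (i + 1)" "a = move b i (i + 1)" by (auto simp: hop_right_def)
    then show ?thesis by (intro image_eqI[of _ _ i]) (auto simp: move_def fun_eq_iff)
  qed
qed

lemma card_targets:
  assumes "a \<in> H"
  shows "finite {b \<in> H. asep_rate p q a b \<noteq> 0}"
    "card {b \<in> H. asep_rate p q a b \<noteq> 0} \<le> 1 + 2 * card (defects a)"
proof -
  let ?D = "defects a" let ?T = "insert 0 (?D \<union> (\<lambda>i. i - 1) ` ?D)" let ?E = "{i. a i \<noteq> a (i + 1)}"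
  have fin: "finite ?D" using assms by (simp add: H_iff)
  have sub: "?E \<subseteq> ?T"
  proof
    fix i assume "i \<in> ?E"
    then have "i = 0 \<or> i \<in> ?D \<or> i + 1 \<in> ?D" by (auto simp: defects_def)
    then show "i \<in> ?T" by force
  qed
  then have finE: "finite ?E" by (rule finite_subset) (simp add: fin)
  then show "finite {b \<in> H. asep_rate p q a b \<noteq> 0}"
    by (rule finite_subset[OF targets_subset finite_imageI])
  have "card {b \<in> H. asep_rate p q a b \<noteq> 0} \<le> card ?E"
    using card_mono[OF finite_imageI[OF finE] targets_subset] card_image_le[OF finE] by (rule le_trans)
  also have "\<dots> \<le> card ?T" using sub fin by (intro card_mono) auto
  also have "\<dots> \<le> 1 + card (?D \<union> (\<lambda>i. i - 1) ` ?D)"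
    by (simp add: card_insert_if fin)
  also have "\<dots> \<le> 1 + (card ?D + card ((\<lambda>i. i - 1) ` ?D))" using card_Un_le by simp
  also have "\<dots> \<le> 1 + 2 * card ?D" using card_image_le[OF fin, of "\<lambda>i. i - 1"] by simp
  finally show "card {b \<in> H. asep_rate p q a b \<noteq> 0} \<le> 1 + 2 * card ?D" .
qed

sublocale chain: jump_chain H "asep_rate p q"
  by unfold_locales (auto simp: countable_H asep_rate_nonneg card_targets)

text \<open>
  A jump needs neighbouring sites with different values, and except for the pair \<open>0, 1\<close> one of
  them is a defect.
\<close>

lemma exit_rate_le:
  assumes "a \<in> H"
  shows "ennreal (exit_rate H (asep_rate p q) a) \<le> 1 + 2 * defect_count a"
proof -
  let ?T = "{b \<in> H. asep_rate p q a b \<noteq> 0}"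
  have "ennreal (exit_rate H (asep_rate p q) a) = (\<Sum>b\<in>?T. ennreal (asep_rate p q a b))"
    unfolding chain.sum_rates[OF assms, symmetric]
    by (rule nn_integral_count_space') (use card_targets[OF assms] in auto)
  also have "\<dots> \<le> (\<Sum>b\<in>?T. 1)"
    by (intro sum_mono) (metis asep_rate_le_1 ennreal_1 ennreal_leI)
  also have "\<dots> = of_nat (card ?T)" by simp
  also have "\<dots> \<le> of_nat (1 + 2 * card (defects a))"
    using card_targets(2)[OF assms] by (simp only: of_nat_le_iff)
  also have "\<dots> = 1 + 2 * defect_count a" by (simp add: defect_count_eq[OF assms])
  finally show ?thesis .
qed

lemma emeasure_nu:
  assumes "A \<in> sets \<pi>"
  shows "emeasure (nu p q c n) A = emeasure \<pi> (H_level n \<inter> A) / emeasure \<pi> (H_level n)"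
  unfolding nu_def by (rule emeasure_uniform_measure) (use assms in auto)

lemma measure_nu:
  assumes "A \<in> sets \<pi>"
  shows "measure (nu p q c n) A * weight p q c n = measure \<pi> (H_level n \<inter> A)"
proof -
  have "emeasure (nu p q c n) A = ennreal (measure \<pi> (H_level n \<inter> A) / measure \<pi> (H_level n))"
    unfolding emeasure_nu[OF assms] \<pi>.emeasure_eq_measure
    by (rule divide_ennreal) (simp_all add: measure_level_pos)
  then have "measure (nu p q c n) A = measure \<pi> (H_level n \<inter> A) / measure \<pi> (H_level n)"
    by (simp add: measure_eq_emeasure_eq_ennreal)
  then show ?thesis
    using measure_level_pos[of n] by (simp add: measure_level_eq_weight)
qed

lemma emeasure_level: "emeasure \<pi> (H_level n) \<noteq> 0" "emeasure \<pi> (H_level n) \<noteq> \<infinity>"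
  using measure_level_pos[of n] by (auto simp: \<pi>.emeasure_eq_measure)

lemma prob_space_nu: "prob_space (nu p q c n)"
  unfolding nu_def using emeasure_level by (rule prob_space_uniform_measure)

lemma nu_singleton:
  "emeasure (nu p q c n) {a} = (if a \<in> H_level n then emeasure \<pi> {a} / emeasure \<pi> (H_level n) else 0)"
  unfolding emeasure_nu[OF singleton_in_sets] by simp

lemma nu_reversible:
  "emeasure (nu p q c n) {a} * ennreal (asep_rate p q a b) =
   emeasure (nu p q c n) {b} * ennreal (asep_rate p q b a)"
proof (cases "hop_right a b \<or> hop_right b a")
  case False
  then show ?thesis by (simp add: asep_rate_eq)
next
  case True
  then have level: "a \<in> H_level n \<longleftrightarrow> b \<in> H_level n" using hop_right_level by blast
  have "measure \<pi> {a} * asep_rate p q a b = measure \<pi> {b} * asep_rate p q b a"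
    using measure_hop_right[of a b] measure_hop_right[of b a]
    by (auto simp: asep_rate_eq algebra_simps)
  then have "ennreal (measure \<pi> {a} * asep_rate p q a b) = ennreal (measure \<pi> {b} * asep_rate p q b a)"
    by simp
  then have "emeasure \<pi> {a} * ennreal (asep_rate p q a b) = emeasure \<pi> {b} * ennreal (asep_rate p q b a)"
    by (simp add: \<pi>.emeasure_eq_measure ennreal_mult asep_rate_nonneg)
  then show ?thesis
    using level unfolding nu_singleton by (simp add: ennreal_divide_mult)
qed

text \<open>
  The stationary mean of the jump rate is finite, although the rates are unbounded.
\<close>

lemma nu_exit_rate:
  "(\<integral>\<^sup>+ a. emeasure (nu p q c n) {a} * ennreal (exit_rate H (asep_rate p q) a) \<partial>count_space H) < \<infinity>"
proof -
  let ?Z = "emeasure \<pi> (H_level n)"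
  have "(\<integral>\<^sup>+ a. emeasure (nu p q c n) {a} * ennreal (exit_rate H (asep_rate p q) a) \<partial>count_space H)
      \<le> (\<integral>\<^sup>+ a. (emeasure \<pi> {a} / ?Z) * (1 + 2 * defect_count a) \<partial>count_space H)"
    by (intro nn_integral_mono mult_mono) (auto simp: nu_singleton exit_rate_le)
  also have "\<dots> = (\<integral>\<^sup>+ a. emeasure \<pi> {a} * (1 + 2 * defect_count a) \<partial>count_space H) / ?Z"
    unfolding ennreal_divide_mult by (rule nn_integral_divide) simp
  also have "\<dots> \<le> (\<integral>\<^sup>+ a. 1 + 2 * defect_count a \<partial>\<pi>) / ?Z"
    by (intro divide_right_mono_ennreal nn_integral_count_space_le countable_H singleton_in_sets)
  also have "\<dots> = (1 + 2 * (\<integral>\<^sup>+ a. defect_count a \<partial>\<pi>)) / ?Z"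
    by (simp add: nn_integral_add nn_integral_cmult \<pi>.emeasure_space_1[simplified])
  also have "\<dots> < \<infinity>"
    using defect_count_integral emeasure_level[of n]
    by (simp add: ennreal_divide_eq_top_iff less_top[symmetric] ennreal_mult_eq_top_iff)
  finally show ?thesis .
qed

lemma AE_nu_level: "AE a in nu p q c n. a \<in> H_level n"
  unfolding nu_def by (rule AE_uniform_measureI) auto

lemma nu_stationary: "stationary_distribution H (asep_rate p q) (nu p q c n)"
  unfolding stationary_distribution_def
proof (intro conjI allI impI ballI)
  show "AE a in nu p q c n. a \<in> H"
    using AE_nu_level by eventually_elim (simp add: H_level_def)
qed (auto intro!: chain.reversible_imp_stationary nu_reversible nu_exit_rate prob_space_nu)

lemma nu_singleton_pos: "a \<in> H_level n \<Longrightarrow> emeasure (nu p q c n) {a} \<noteq> 0"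
  using measure_singleton_pos[of a] emeasure_level[of n]
  by (auto simp: nu_singleton H_level_def \<pi>.emeasure_eq_measure ennreal_divide_eq_0_iff)

text \<open>
  Started outside an invariant set, the chain cannot enter it, in particular not by the jump from
  \<open>a\<close> to \<open>b\<close>. As \<open>nu p q c n\<close> charges every point of the level, the almost sure identity in
  the definition of invariance holds at \<open>a\<close>.
\<close>

lemma invariant_not_mem_hop:
  assumes inv: "invariant_set H (asep_rate p q) (nu p q c n) A"
    and a: "a \<in> H_level n" and b: "b \<in> H_level n" and rate: "asep_rate p q a b > 0"
    and "a \<notin> A"
  shows "b \<notin> A"
proof
  assume "b \<in> A"
  have H: "a \<in> H" "b \<in> H" using a b by (auto simp: H_level_def)
  let ?P = "\<lambda>x. (\<integral>\<^sup>+ y. transition H (asep_rate p q) 1 x y \<partial>count_space A) = indicator A x"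
  have "AE x in nu p q c n. ?P x"
    using inv by (auto simp: invariant_set_def)
  then obtain M where M: "{x \<in> space (nu p q c n). \<not> ?P x} \<subseteq> M" "emeasure (nu p q c n) M = 0"
    "M \<in> sets (nu p q c n)" by (rule AE_E)
  have "?P a"
  proof (rule ccontr)
    assume "\<not> ?P a"
    then have "{a} \<subseteq> M" using M(1) by (auto simp: nu_def)
    then have "emeasure (nu p q c n) {a} \<le> 0" using emeasure_mono[OF _ M(3)] M(2) by metis
    then show False using nu_singleton_pos[OF a] by simp
  qed
  then have "transition H (asep_rate p q) 1 a b \<le> 0"
    using nn_integral_ge_point[OF \<open>b \<in> A\<close>, of "transition H (asep_rate p q) 1 a"] \<open>a \<notin> A\<close> by simp
  then show False using chain.transition_pos[OF H rate, of 1] by simp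
qed

lemma nu_ergodic: "ergodic_distribution H (asep_rate p q) (nu p q c n)"
  unfolding ergodic_distribution_def
proof (intro conjI allI impI nu_stationary)
  fix A assume inv: "invariant_set H (asep_rate p q) (nu p q c n) A"
  have "a \<in> A \<longleftrightarrow> step n \<in> A" if "a \<in> H_level n" for a
  proof (rule level_connected[OF _ that])
    fix a b assume "a \<in> H_level n" "b \<in> H_level n" "hop_right a b"
    then show "a \<in> A \<longleftrightarrow> b \<in> A"
      using invariant_not_mem_hop[OF inv, of a b] invariant_not_mem_hop[OF inv, of b a] pq_pos
      by (auto simp: asep_rate_eq add_pos_nonneg add_nonneg_pos)
  qed
  then have "H_level n \<inter> A = H_level n \<or> H_level n \<inter> A = {}" by blast
  moreover have "A \<in> sets \<pi>"
    using inv by (intro subset_H_in_sets) (simp add: invariant_set_def)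
  ultimately show "emeasure (nu p q c n) A = 0 \<or> emeasure (nu p q c n) A = 1"
    using emeasure_level[of n] by (auto simp: emeasure_nu ennreal_divide_self less_top[symmetric])
qed

end

theorem mainTheorem4:
  fixes p q c :: real
  assumes "1 / 2 < p" and "p = 1 - q" and "p < 1"
  shows "(\<forall>n. measure (blocking p q c) (H_level n) = weight p q c n) \<and>
    (\<forall>n. ergodic_distribution H (asep_rate p q) (nu p q c n)) \<and>
    (\<forall>A\<in>sets (blocking p q c).
       ((\<lambda>n. measure (nu p q c n) A * weight p q c n) has_sum measure (blocking p q c) A) UNIV)"
proof -
  interpret asep p q c using assms by unfold_locales
  show ?thesis
    by (auto simp: measure_level_eq_weight nu_ergodic measure_nu has_sum_levels cong: has_sum_cong)
qed

end
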